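(* Let $k\geq\ell\geq t+1$ be positive integers ($t\ge 1$) and let $r\geq 1$ be real. Let $\Omega$ be a finite set and let $\mathcal{A}\subseteq\binom{\Omega}{k}$ and $\mathcal{B}\subseteq\binom{\Omega}{\ell}$ be two weakly $(r,t)$-spread families. The following hold. (i) If $r\geq 2ek$ and $\mathcal{F}\subseteq\mathcal{A}$ is $t$-intersecting, then $|\mathcal{F}|\leq\Delta_{t}(\mathcal{A})$, with equality if and only if $\mathcal{F}=\mathcal{A}[X]$ for some $X\in\binom{\Omega}{t}$ with $|\mathcal{A}[X]|=\Delta_{t}(\mathcal{A})$. (ii) If $r\geq 2e\cdot\max\{(t+2)^2,\,k/(1-t/k)\}$ and $\mathcal{F}\subseteq\mathcal{A}$, $\mathcal{G}\subseteq\mathcal{B}$ are cross $t$-intersecting, then $|\mathcal{F}||\mathcal{G}|\leq\Delta_{t}(\mathcal{A})\Delta_{t}(\mathcal{B})$, with equality if and only if $\mathcal{F}=\mathcal{A}[X]$ and $\mathcal{G}=\mathcal{B}[X]$ for some $X\in\binom{\Omega}{t}$ with $|\mathcal{A}[X]|=\Delta_{t}(\mathcal{A})$ and $|\mathcal{B}[X]|=\Delta_{t}(\mathcal{B})$.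
   Context: Here $e$ is the base of the natural logarithm, and $\binom{\Omega}{k}$ is the family of all $k$-element subsets of $\Omega$. For a family $\mathcal{A}$ of subsets of $\Omega$ and $S\subseteq\Omega$, $\mathcal{A}[S]:=\{A\in\mathcal{A}:S\subseteq A\}$. The maximum $s$-degree of $\mathcal{A}$ is $\Delta_s(\mathcal{A}):=\max\{|\mathcal{A}[S]|:S\in\binom{\Omega}{s}\}$ (taken to be $0$ if $s>|\Omega|$). A family $\mathcal{A}$ is weakly $(r,t)$-spread if $\Delta_{t+s}(\mathcal{A})\leq r^{-s}\Delta_t(\mathcal{A})$ for all integers $s\ge 0$. A family $\mathcal{F}$ is $t$-intersecting if $|F\cap F'|\ge t$ for all $F,F'\in\mathcal{F}$. Families $\mathcal{F},\mathcal{G}$ are cross $t$-intersecting if $|F\cap G|\ge t$ for all $F\in\mathcal{F}$, $G\in\mathcal{G}$.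
   Formalization: The equality characterizations are asserted only when |Ω| ≥ t, and in (ii) only when A and B are both empty or both nonempty; in the excluded degenerate cases (e.g. A empty, B nonempty, F=G=∅) they are false. *)

theory Defs
  imports Complex_Main "HOL-Library.Ramsey"
begin

definition containing :: "'a set set \<Rightarrow> 'a set \<Rightarrow> 'a set set" where
  "containing \<A> S = {A \<in> \<A>. S \<subseteq> A}"

text \<open>The ground set \<open>\<Omega>\<close> is explicit and is meant to be finite; then the \<open>Max\<close> below ranges over
  a finite set, which is nonempty exactly when \<open>s \<le> card \<Omega>\<close>.\<close>

definition max_degree :: "'a set \<Rightarrow> nat \<Rightarrow> 'a set set \<Rightarrow> nat" where
  "max_degree \<Omega> s \<A> =
     (if s \<le> card \<Omega> then Max ((\<lambda>S. card (containing \<A> S)) ` nsets \<Omega> s) else 0)"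

definition weakly_spread :: "'a set \<Rightarrow> real \<Rightarrow> nat \<Rightarrow> 'a set set \<Rightarrow> bool" where
  "weakly_spread \<Omega> r t \<A> \<longleftrightarrow>
     (\<forall>s::nat. real (max_degree \<Omega> (t + s) \<A>) \<le> r powi (- int s) * real (max_degree \<Omega> t \<A>))"

definition t_intersecting :: "nat \<Rightarrow> 'a set set \<Rightarrow> bool" where
  "t_intersecting t \<F> \<longleftrightarrow> (\<forall>F\<in>\<F>. \<forall>F'\<in>\<F>. t \<le> card (F \<inter> F'))"

definition cross_t_intersecting :: "nat \<Rightarrow> 'a set set \<Rightarrow> 'a set set \<Rightarrow> bool" where
  "cross_t_intersecting t \<F> \<G> \<longleftrightarrow> (\<forall>F\<in>\<F>. \<forall>G\<in>\<G>. t \<le> card (F \<inter> G))"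

end

theory Submission imports Defs begin

text \<open>
  A family is replaced by a larger one of subsets of \<open>\<Omega>\<close>, saturated for the \<open>t\<close>-intersection
  property among sets of size at most \<open>t + s\<close>, and the minimal members of the top size \<open>t + s\<close>
  are peeled off, for \<open>s = k - t, \<dots>, 1\<close>. Saturation forces every proper subset of a minimal
  member to miss the \<open>t\<close>-intersection condition with some set, so minimal members are found by a
  branching search, which bounds their number; the spread condition bounds the number of members of
  \<open>\<A>\<close> above each of them. Altogether the \<open>s\<close>-th step loses at most a \<open>2\<^sup>-\<^sup>s\<close> fraction of the
  extremal value (of the product of the two extremal values for cross-intersecting pairs). If all
  sets left after a step share a common \<open>t\<close>-set \<open>X\<close> while some peeled set \<open>W\<close> does not contain
  \<open>X\<close>, then every remaining set contains \<open>X\<close> and an element of \<open>W - X\<close>; there are few such sets.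
  Hence a family whose members have no common \<open>t\<close>-subset is strictly smaller than the extremal value.
\<close>

section \<open>Sets above a family, and the spread condition\<close>

text \<open>Sets are always counted in the fixed family \<open>\<A>\<close>, while
  \<open>\<T>\<close> runs through families of generating sets that need not belong to
  \<open>\<A>\<close>.\<close>

definition above :: "'a set set \<Rightarrow> 'a set set \<Rightarrow> 'a set set" where
  "above \<A> \<T> = {A \<in> \<A>. \<exists>T\<in>\<T>. T \<subseteq> A}"

text \<open>Minimality refers to all of \<open>\<U>\<close>: no proper subset of a layer member
  belongs to \<open>\<U>\<close>, and saturation turns this into a set which such a subset meets in
  fewer than \<open>t\<close> elements.\<close>

definition layer :: "'a set set \<Rightarrow> nat \<Rightarrow> 'a set set" where
  "layer \<U> n = {W \<in> \<U>. card W = n \<and> (\<forall>X. X \<subset> W \<longrightarrow> X \<notin> \<U>)}"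

lemma card_containing_le_max_degree:
  assumes "finite \<Omega>" "S \<in> nsets \<Omega> n"
  shows "card (containing \<A> S) \<le> max_degree \<Omega> n \<A>"
proof -
  have "n \<le> card \<Omega>"
    using assms by (auto simp: nsets_def intro: card_mono)
  moreover have "finite (nsets \<Omega> n)"
    using assms(1) by (rule finite_imp_finite_nsets)
  ultimately show ?thesis
    using assms(2) unfolding max_degree_def by (auto intro!: Max_ge)
qed

lemma card_containing_spread:
  assumes "finite \<Omega>" "weakly_spread \<Omega> r t \<A>" "S \<in> nsets \<Omega> (t + i)"
  shows "real (card (containing \<A> S)) \<le> real (max_degree \<Omega> t \<A>) / r ^ i"
proof -
  have "real (card (containing \<A> S)) \<le> real (max_degree \<Omega> (t + i) \<A>)"
    using card_containing_le_max_degree[OF assms(1,3)] by simp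
  also have "\<dots> \<le> r powi (- int i) * real (max_degree \<Omega> t \<A>)"
    using assms(2) unfolding weakly_spread_def by blast
  also have "\<dots> = real (max_degree \<Omega> t \<A>) / r ^ i"
    by (simp add: power_int_minus divide_inverse)
  finally show ?thesis .
qed

text \<open>Union bound over \<open>\<W>\<close>. The spread condition enters all later estimates
  through this bound.\<close>

lemma card_above_uniform:
  assumes "finite \<Omega>" "\<A> \<subseteq> Pow \<Omega>" "weakly_spread \<Omega> r t \<A>" "\<W> \<subseteq> nsets \<Omega> (t + i)"
  shows "real (card (above \<A> \<W>)) \<le> real (card \<W>) * (real (max_degree \<Omega> t \<A>) / r ^ i)"
proof -
  have fin: "finite \<W>"
    using assms(1,4) finite_imp_finite_nsets finite_subset by metis
  have "above \<A> \<W> = (\<Union>W\<in>\<W>. containing \<A> W)"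
    by (auto simp: above_def containing_def)
  then have "real (card (above \<A> \<W>)) \<le> (\<Sum>W\<in>\<W>. real (card (containing \<A> W)))"
    using card_UN_le[OF fin, of "containing \<A>"] by (simp flip: of_nat_sum)
  also have "\<dots> \<le> (\<Sum>W\<in>\<W>. real (max_degree \<Omega> t \<A>) / r ^ i)"
    using card_containing_spread[OF assms(1,3)] assms(4) by (intro sum_mono) auto
  finally show ?thesis by simp
qed

lemma above_mono: "\<S> \<subseteq> \<T> \<Longrightarrow> above \<A> \<S> \<subseteq> above \<A> \<T>"
  by (auto simp: above_def)

lemma above_subset: "above \<A> \<T> \<subseteq> \<A>"
  by (auto simp: above_def)

lemma subset_above: "\<F> \<subseteq> \<A> \<Longrightarrow> \<F> \<subseteq> above \<A> \<F>"
  by (auto simp: above_def)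

section \<open>Minimal members and the top layer\<close>

lemma ex_minimal_member:
  assumes "T \<in> \<U>" "finite T"
  obtains n where "\<exists>W\<in>layer \<U> n. W \<subseteq> T"
proof -
  have "finite {W \<in> \<U>. W \<subseteq> T}"
    using assms(2) by simp
  from finite_has_minimal2[OF this, of T] assms(1)
  obtain W where W: "W \<in> \<U>" "W \<subseteq> T" "\<And>X. X \<in> \<U> \<Longrightarrow> X \<subseteq> T \<Longrightarrow> X \<subseteq> W \<Longrightarrow> W = X"
    by auto
  then have "W \<in> layer \<U> (card W)"
    unfolding layer_def by (auto 4 4)
  with W(2) that show thesis by blast
qed

lemma above_subset_layers:
  assumes "\<And>U. U \<in> \<U> \<Longrightarrow> finite U \<and> t + u \<le> card U \<and> card U \<le> t + s"
  shows "above \<A> \<U> \<subseteq> (\<Union>i\<in>{u..s}. above \<A> (layer \<U> (t + i)))"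
proof
  fix A assume "A \<in> above \<A> \<U>"
  then obtain T where T: "A \<in> \<A>" "T \<in> \<U>" "T \<subseteq> A"
    by (auto simp: above_def)
  then obtain n W where W: "W \<in> layer \<U> n" "W \<subseteq> T"
    using ex_minimal_member assms by metis
  then have "W \<in> \<U>" "card W = n"
    by (auto simp: layer_def)
  then have n: "t + u \<le> n" "n \<le> t + s"
    using assms[of W] by auto
  then obtain i where i: "n = t + i"
    using le_Suc_ex[of t n] by auto
  then show "A \<in> (\<Union>i\<in>{u..s}. above \<A> (layer \<U> (t + i)))"
    using T W n by (auto simp: above_def intro!: bexI[of _ i])
qed

text \<open>A minimal member below \<open>A\<close> either has size at most \<open>m\<close> and
  survives, or lies in the top layer. So removing all members of size \<open>Suc m\<close> can only
  lose sets above the minimal ones among them.\<close>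

lemma above_subset_top_layer:
  assumes "\<And>U. U \<in> \<U> \<Longrightarrow> finite U \<and> card U \<le> Suc m"
  shows "above \<A> \<U> \<subseteq> above \<A> {U \<in> \<U>. card U \<le> m} \<union> above \<A> (layer \<U> (Suc m))"
proof
  fix A assume "A \<in> above \<A> \<U>"
  then obtain T where T: "A \<in> \<A>" "T \<in> \<U>" "T \<subseteq> A"
    by (auto simp: above_def)
  then obtain n W where W: "W \<in> layer \<U> n" "W \<subseteq> T"
    using ex_minimal_member assms by metis
  then have "W \<in> \<U>" "card W = n"
    by (auto simp: layer_def)
  then have "n = Suc m \<or> W \<in> {U \<in> \<U>. card U \<le> m}"
    using assms[of W] by auto
  then show "A \<in> above \<A> {U \<in> \<U>. card U \<le> m} \<union> above \<A> (layer \<U> (Suc m))"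
    using T W unfolding above_def by blast
qed

section \<open>Branching search for minimal sets\<close>

text \<open>A search tree of depth \<open>q - card X\<close>: while \<open>X\<close> lies properly
  inside some member, every member containing \<open>X\<close> has an element of
  \<open>Z - X\<close>, so at most \<open>c\<close> one-element extensions of \<open>X\<close> cover
  them all. An \<open>X\<close> properly inside no member is contained in at most one.\<close>

lemma card_branching:
  assumes "finite \<W>" and W: "\<And>W. W \<in> \<W> \<Longrightarrow> finite W \<and> card W = q"
    and hit: "\<And>X W. X0 \<subseteq> X \<Longrightarrow> W \<in> \<W> \<Longrightarrow> X \<subset> W \<Longrightarrow>
      \<exists>Z. finite Z \<and> card Z \<le> c \<and> (\<forall>W'\<in>\<W>. X \<subseteq> W' \<longrightarrow> (Z - X) \<inter> W' \<noteq> {})"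
    and "X0 \<subseteq> X" "finite X"
  shows "card {W \<in> \<W>. X \<subseteq> W} \<le> c ^ (q - card X)"
  using assms(4,5)
proof (induction "q - card X" arbitrary: X rule: less_induct)
  case less
  show ?case
  proof (cases "\<exists>W\<in>\<W>. X \<subset> W")
    case False
    show ?thesis
    proof (cases "X \<in> \<W>")
      case True
      with False have "{W \<in> \<W>. X \<subseteq> W} = {X}" by auto
      with W[OF True] show ?thesis by simp
    next
      case False
      with \<open>\<not> (\<exists>W\<in>\<W>. X \<subset> W)\<close> have "{W \<in> \<W>. X \<subseteq> W} = {}" by (auto simp: psubset_eq)
      then show ?thesis by (simp only: card.empty zero_le)
    qed
  next
    case True
    then obtain W0 where W0: "W0 \<in> \<W>" "X \<subset> W0" by blast
    obtain Z where Z: "finite Z" "card Z \<le> c" "\<And>W'. W' \<in> \<W> \<Longrightarrow> X \<subseteq> W' \<Longrightarrow> (Z - X) \<inter> W' \<noteq> {}"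
      using hit[OF less.prems(1) W0] by auto
    have lt: "card X < q"
      using W[OF W0(1)] W0(2) psubset_card_mono[of W0 X] by simp
    have step: "card {W \<in> \<W>. insert y X \<subseteq> W} \<le> c ^ (q - Suc (card X))" if "y \<in> Z - X" for y
    proof -
      have "card (insert y X) = Suc (card X)"
        using that less.prems(2) by simp
      then show ?thesis
        using less.hyps[of "insert y X"] less.prems lt by (simp add: subset_insertI2)
    qed
    have "{W \<in> \<W>. X \<subseteq> W} \<subseteq> (\<Union>y\<in>Z - X. {W \<in> \<W>. insert y X \<subseteq> W})"
    proof
      fix W assume "W \<in> {W \<in> \<W>. X \<subseteq> W}"
      then have "W \<in> \<W>" "X \<subseteq> W" "(Z - X) \<inter> W \<noteq> {}"
        using Z(3) by simp_all
      then show "W \<in> (\<Union>y\<in>Z - X. {W \<in> \<W>. insert y X \<subseteq> W})" by auto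
    qed
    then have "card {W \<in> \<W>. X \<subseteq> W} \<le> card (\<Union>y\<in>Z - X. {W \<in> \<W>. insert y X \<subseteq> W})"
      using Z(1) assms(1) by (intro card_mono) auto
    also have "\<dots> \<le> (\<Sum>y\<in>Z - X. card {W \<in> \<W>. insert y X \<subseteq> W})"
      using Z(1) by (intro card_UN_le) auto
    also have "\<dots> \<le> (\<Sum>y\<in>Z - X. c ^ (q - Suc (card X)))"
      by (intro sum_mono step)
    also have "\<dots> \<le> c * c ^ (q - Suc (card X))"
      using Z(1,2) card_mono[of Z "Z - X"] by auto
    also have "\<dots> = c ^ (q - card X)"
      using lt by (metis Suc_diff_Suc power_Suc)
    finally show ?thesis .
  qed
qed

lemma diff_Int_nonempty:
  assumes "finite X" "card (X \<inter> V) < t" "t \<le> card (W \<inter> V)"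
  shows "(V - X) \<inter> W \<noteq> {}"
proof
  assume "(V - X) \<inter> W = {}"
  then have "W \<inter> V \<subseteq> X \<inter> V" by auto
  then have "card (W \<inter> V) \<le> card (X \<inter> V)"
    using assms(1) by (intro card_mono) auto
  then show False using assms(2,3) by auto
qed

text \<open>Each layer member shares \<open>t\<close> elements with \<open>V1\<close>. This gives
  the starting sets \<open>X0\<close> and the binomial coefficient; from there the search branches
  over members of \<open>\<V>\<close>, which have at most \<open>c\<close> elements, to depth
  \<open>n - t\<close>.\<close>

lemma card_layer_cross:
  assumes fin: "finite \<Omega>" and sub: "\<U> \<subseteq> Pow \<Omega>" "\<V> \<subseteq> Pow \<Omega>"
    and cross: "cross_t_intersecting t \<U> \<V>"
    and sat: "\<And>Y. Y \<subseteq> \<Omega> \<Longrightarrow> card Y \<le> c \<Longrightarrow> (\<And>V. V \<in> \<V> \<Longrightarrow> t \<le> card (Y \<inter> V)) \<Longrightarrow> Y \<in> \<U>"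
    and small: "\<And>U. U \<in> \<U> \<Longrightarrow> card U \<le> c" "\<And>V. V \<in> \<V> \<Longrightarrow> card V \<le> c"
    and V1: "V1 \<in> \<V>"
  shows "card (layer \<U> n) \<le> (card V1 choose t) * c ^ (n - t)"
proof -
  have finU: "finite U" if "U \<in> \<U> \<or> U \<in> \<V>" for U
    using that sub finite_subset[OF _ fin] by auto
  have finL: "finite (layer \<U> n)"
    using finite_subset[of "layer \<U> n" "Pow \<Omega>"] sub(1) fin by (auto simp: layer_def)
  have cov: "layer \<U> n = (\<Union>X\<in>nsets V1 t. {W \<in> layer \<U> n. X \<subseteq> W})"
  proof (intro equalityI subsetI)
    fix W assume W: "W \<in> layer \<U> n"
    then have "t \<le> card (W \<inter> V1)"
      using cross V1 by (auto simp: layer_def cross_t_intersecting_def)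
    then obtain X where "X \<subseteq> W \<inter> V1" "card X = t" "finite X"
      by (rule obtain_subset_with_card_n)
    then show "W \<in> (\<Union>X\<in>nsets V1 t. {W \<in> layer \<U> n. X \<subseteq> W})"
      using W by (auto simp: nsets_def)
  qed auto
  have each: "card {W \<in> layer \<U> n. X0 \<subseteq> W} \<le> c ^ (n - t)" if X0: "X0 \<in> nsets V1 t" for X0
  proof -
    have "card {W \<in> layer \<U> n. X0 \<subseteq> W} \<le> c ^ (n - card X0)"
    proof (rule card_branching[where X0 = X0])
      fix X W assume X: "X0 \<subseteq> X" "W \<in> layer \<U> n" "X \<subset> W"
      then have W: "W \<in> \<U>" "X \<notin> \<U>"
        by (auto simp: layer_def)
      have "W \<subseteq> \<Omega>"
        using W(1) sub(1) by auto
      then have "X \<subseteq> \<Omega>"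
        using X(3) by auto
      have "card X \<le> card W"
        using finU W(1) X(3) by (intro card_mono) auto
      then have "card X \<le> c"
        using small(1)[OF W(1)] by linarith
      \<comment> \<open>\<open>X\<close> is outside \<open>\<U>\<close> by minimality of
        \<open>W\<close>, so saturation yields a \<open>V\<close> that \<open>X\<close> meets in
        fewer than \<open>t\<close> elements. All layer members meet this \<open>V\<close> in at
        least \<open>t\<close>, hence also outside \<open>X\<close>.\<close>
      then obtain V where V: "V \<in> \<V>" "card (X \<inter> V) < t"
        using sat[OF \<open>X \<subseteq> \<Omega>\<close>] W(2) not_le by metis
      have "finite X"
        using \<open>X \<subseteq> \<Omega>\<close> fin finite_subset by metis
      have "(V - X) \<inter> W' \<noteq> {}" if "W' \<in> layer \<U> n" for W'
        using that cross V \<open>finite X\<close>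
        by (intro diff_Int_nonempty[where t = t]) (auto simp: layer_def cross_t_intersecting_def)
      then show "\<exists>Z. finite Z \<and> card Z \<le> c \<and> (\<forall>W'\<in>layer \<U> n. X \<subseteq> W' \<longrightarrow> (Z - X) \<inter> W' \<noteq> {})"
        using V small(2)[OF V(1)] finU[of V] by (intro exI[of _ V]) simp
    next
      show "finite W \<and> card W = n" if "W \<in> layer \<U> n" for W
        using that finU[of W] by (simp add: layer_def)
    qed (use X0 finL in \<open>simp_all add: nsets_def\<close>)
    then show ?thesis
      using X0 by (simp add: nsets_def)
  qed
  have finV1: "finite V1" using finU V1 by blast
  have "card (layer \<U> n) \<le> (\<Sum>X\<in>nsets V1 t. card {W \<in> layer \<U> n. X \<subseteq> W})"
    using card_UN_le[OF finite_imp_finite_nsets[OF finV1]] cov by metis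
  also have "\<dots> \<le> (\<Sum>X\<in>nsets V1 t. c ^ (n - t))"
    by (intro sum_mono each)
  also have "\<dots> = (card V1 choose t) * c ^ (n - t)"
    using card_nsets[of V1 t] finV1 by simp
  finally show ?thesis .
qed

section \<open>Numerical estimates for the thresholds\<close>

text \<open>The quadratic Taylor bound at \<open>1/4\<close> is \<open>41/32\<close>, and its fourth
  power is about 2.695. The value \<open>8/3\<close> turns the factor \<open>2 * exp 1\<close> of
  the thresholds into \<open>16/3\<close>.\<close>

lemma exp_one_ge: "exp (1::real) \<ge> 8/3"
proof -
  have "(1::real) + 1/4 + (1/4)\<^sup>2/2 \<le> exp (1/4)"
    by (rule exp_lower_Taylor_quadratic) simp
  then have "(41/32::real) ^ 4 \<le> exp (1/4) ^ 4"
    by (intro power_mono) (simp_all add: power2_eq_square)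
  also have "\<dots> = exp (1::real)"
    by (simp flip: exp_of_nat_mult)
  finally show ?thesis by (simp add: power4_eq_xxxx)
qed

text \<open>Induction by \<open>(1 + 1/n) ^ n \<le> exp 1\<close>. The exponent \<open>m\<close>
  instead of \<open>Suc m\<close> saves a factor \<open>exp 1\<close>, needed for the constants
  later.\<close>

lemma power_self_le_fact: "real (Suc m) ^ Suc m \<le> fact (Suc m) * exp 1 ^ m"
proof (induction m)
  case (Suc m)
  have "1 + 1 / real (Suc m) \<le> exp (1 / real (Suc m))"
    using exp_ge_add_one_self by (simp add: add.commute)
  then have "(1 + 1 / real (Suc m)) ^ Suc m \<le> exp (1 / real (Suc m)) ^ Suc m"
    by (intro power_mono) auto
  also have "\<dots> = exp 1"
    using exp_of_nat_mult[of "Suc m" "1 / real (Suc m)"] by simp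
  finally have "(1 + 1 / real (Suc m)) ^ Suc m \<le> exp 1" .
  then have "real (Suc m) ^ Suc m * (1 + 1 / real (Suc m)) ^ Suc m \<le> (fact (Suc m) * exp 1 ^ m) * exp 1"
    using Suc.IH by (intro mult_mono) auto
  moreover have "real (Suc m) ^ Suc m * (1 + 1 / real (Suc m)) ^ Suc m = real (Suc (Suc m)) ^ Suc m"
  proof -
    have "real (Suc m) * (1 + 1 / real (Suc m)) = real (Suc (Suc m))"
      by (simp add: field_simps)
    then show ?thesis
      by (simp only: power_mult_distrib[symmetric])
  qed
  ultimately have "real (Suc (Suc m)) ^ Suc m \<le> fact (Suc m) * exp 1 ^ m * exp 1"
    by (simp only:)
  then have "real (Suc (Suc m)) * real (Suc (Suc m)) ^ Suc m
      \<le> real (Suc (Suc m)) * (fact (Suc m) * exp 1 ^ m * exp 1)"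
    by (intro mult_left_mono) auto
  moreover have "real (Suc (Suc m)) * (fact (Suc m) * exp 1 ^ m * exp 1)
      = fact (Suc (Suc m)) * exp 1 ^ Suc m"
    by (simp only: fact_Suc[of "Suc m"] power_Suc mult_ac)
  ultimately show ?case
    by (simp only: power_Suc)
qed simp

text \<open>One term of the binomial expansion of \<open>(p + (1 - p)) ^ (t + j)\<close>.\<close>

lemma binomial_term_le_one:
  fixes p :: real
  assumes "0 \<le> p" "p \<le> 1"
  shows "real ((t + j) choose t) * p ^ j * (1 - p) ^ t \<le> 1"
proof -
  have "real ((t + j) choose j) * p ^ j * (1 - p) ^ (t + j - j)
      \<le> (\<Sum>i\<le>t + j. real ((t + j) choose i) * p ^ i * (1 - p) ^ (t + j - i))"
    using assms by (intro member_le_sum[of j "{..t + j}"]) auto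
  also have "\<dots> = (p + (1 - p)) ^ (t + j)"
    by (simp only: binomial_ring)
  finally show ?thesis
    using binomial_symmetric[of t "t + j"] by simp
qed

text \<open>Raising \<open>u\<close> by one multiplies the coefficient by
  \<open>(t + u + 1) / (u + 1)\<close>, which is at most \<open>t + 1\<close>.\<close>

lemma binomial_le_power: "(t + u) choose t \<le> Suc t ^ u"
proof (induction u)
  case (Suc u)
  have "Suc u * ((t + Suc u) choose Suc u) = (t + Suc u) * ((t + u) choose u)"
    using Suc_times_binomial[of u "t + u"] by simp
  also have "\<dots> \<le> (Suc t * Suc u) * ((t + u) choose u)"
    by (intro mult_right_mono) auto
  finally have "Suc u * ((t + Suc u) choose Suc u) \<le> Suc u * (Suc t * ((t + u) choose u))"
    by (simp only: mult_ac)
  then have "(t + Suc u) choose Suc u \<le> Suc t * ((t + u) choose u)"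
    using Suc_mult_le_cancel1 by blast
  also have "\<dots> \<le> Suc t * Suc t ^ u"
    using Suc.IH binomial_symmetric[of t "t + u"] by (intro mult_left_mono) auto
  finally show ?case
    using binomial_symmetric[of t "t + Suc u"] by simp
qed simp

text \<open>The coefficient is at most \<open>n ^ s / fact i\<close>; what remains is a partial sum
  of the exponential series at \<open>s\<close>.\<close>

lemma sum_binomial_le_exp:
  assumes "1 \<le> n"
  shows "(\<Sum>i\<le>s. real (n choose i) * real s ^ i) \<le> (exp 1 * real n) ^ s"
proof -
  have "(\<Sum>i\<le>s. real (n choose i) * real s ^ i) \<le> (\<Sum>i\<le>s. real n ^ s * (real s ^ i / fact i))"
  proof (intro sum_mono)
    fix i assume "i \<in> {..s}"
    have "real (n choose i) * fact i \<le> real n ^ i"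
      using binomial_fact_pow[of n i] by (metis of_nat_fact of_nat_le_iff of_nat_mult of_nat_power)
    also have "\<dots> \<le> real n ^ s"
      using \<open>i \<in> {..s}\<close> assms by (intro power_increasing) auto
    finally have "real (n choose i) \<le> real n ^ s / fact i"
      by (simp add: field_simps)
    then have "real (n choose i) * real s ^ i \<le> real n ^ s / fact i * real s ^ i"
      by (intro mult_right_mono) auto
    then show "real (n choose i) * real s ^ i \<le> real n ^ s * (real s ^ i / fact i)"
      by simp
  qed
  also have "\<dots> = real n ^ s * (\<Sum>i\<le>s. real s ^ i /\<^sub>R fact i)"
    by (simp add: sum_distrib_left divide_inverse mult_ac)
  also have "\<dots> \<le> real n ^ s * exp (real s)"
    unfolding exp_def by (intro mult_left_mono sum_le_suminf summable_exp_generic) auto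
  also have "exp (real s) = exp 1 ^ s"
    using exp_of_nat_mult[of s 1] by simp
  finally show ?thesis
    by (simp add: power_mult_distrib mult_ac)
qed

text \<open>As a function of \<open>s\<close> the quotient falls up to \<open>s = t\<close> and
  rises afterwards, so it is largest at an end of the range from \<open>1\<close> to
  \<open>k - t\<close>. At \<open>s = k - t\<close> it is the second term of the maximum, at
  \<open>s = 1\<close> it is \<open>(t + 1)^2\<close>.\<close>

lemma spread_threshold:
  assumes "1 \<le> s" "t + s \<le> k" "1 \<le> t"
  shows "(real t + real s)\<^sup>2 / real s \<le> max ((real t + 2)\<^sup>2) (real k / (1 - real t / real k))"
proof -
  define n where "n = real k - real t"
  have n: "real s \<le> n" "n > 0" "real k = real t + n"
    using assms by (auto simp: n_def)
  have eq: "real k / (1 - real t / real k) = (real t + n)\<^sup>2 / n"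
    using n assms by (simp add: field_simps power2_eq_square)
  show ?thesis
  proof (cases "t \<le> s")
    case True
    have "real t * real t \<le> n * real s"
      using True n assms by (intro mult_mono) auto
    \<comment> \<open>\<open>(t + n)^2 * s - (t + s)^2 * n = (n - s) * (n * s - t^2)\<close>.\<close>
    then have "0 \<le> (n - real s) * (n * real s - real t * real t)"
      using n by auto
    then have "(real t + real s)\<^sup>2 * n \<le> (real t + n)\<^sup>2 * real s"
      by (simp add: algebra_simps power2_eq_square)
    then have "(real t + real s)\<^sup>2 / real s \<le> (real t + n)\<^sup>2 / n"
      using n assms by (simp add: field_simps)
    then show ?thesis using eq by simp
  next
    case False
    have "real s * 1 \<le> real t * real t"
      using False assms by (intro mult_mono) auto
    \<comment> \<open>\<open>(t + 1)^2 * s - (t + s)^2 = (s - 1) * (t^2 - s)\<close>.\<close>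
    then have "0 \<le> (real s - 1) * (real t * real t - real s)"
      using assms by auto
    then have "(real t + real s)\<^sup>2 \<le> (real t + 1)\<^sup>2 * real s"
      by (simp add: algebra_simps power2_eq_square)
    also have "\<dots> \<le> (real t + 2)\<^sup>2 * real s"
      by (intro mult_right_mono power_mono) auto
    finally have "(real t + real s)\<^sup>2 / real s \<le> (real t + 2)\<^sup>2"
      using assms by (simp add: field_simps)
    then show ?thesis by simp
  qed
qed

text \<open>With \<open>q = t + s\<close>, the coefficient is at most \<open>q ^ s / fact s\<close>,
  the threshold gives \<open>q / r \<le> s / (2 * exp 1 * q)\<close>, and
  \<open>s ^ s \<le> fact s * exp 1 ^ (s - 1)\<close>. In the product everything cancels but
  \<open>(1/2) ^ s / exp 1\<close>.\<close>

lemma top_layer_weight: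
  assumes "1 \<le> s" "t + s \<le> k" "1 \<le> t"
    and r: "2 * exp 1 * max ((real t + 2)\<^sup>2) (real k / (1 - real t / real k)) \<le> r"
  shows "real ((t + s) choose t) * (real (t + s) / r) ^ s \<le> (1/2) ^ s / exp 1"
proof -
  define q where "q = real (t + s)"
  define M where "M = 2 * exp 1 * (q\<^sup>2 / real s)"
  have "q > 0" and M0: "M > 0" using assms by (auto simp: q_def M_def)
  have "M \<le> r"
    using r spread_threshold[OF assms(1-3)] unfolding M_def q_def
    by (smt (verit) exp_gt_zero mult_left_mono of_nat_add)
  obtain m where m: "s = Suc m" using assms(1) by (cases s) auto
  have C: "real ((t + s) choose t) * fact s \<le> q ^ s"
    using binomial_fact_pow[of "t + s" s] binomial_symmetric[of t "t + s"]
    by (metis add_diff_cancel_left' le_add1 of_nat_fact of_nat_le_iff of_nat_mult of_nat_power q_def)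
  have S: "real s ^ s \<le> fact s * exp 1 ^ m"
    using power_self_le_fact[of m] m by simp
  have "(q / r) ^ s \<le> (q / M) ^ s"
    using \<open>M \<le> r\<close> M0 \<open>q > 0\<close> by (intro power_mono divide_left_mono) auto
  also have "q / M = (1/2) * (real s / (exp 1 * q))"
    using \<open>q > 0\<close> assms by (simp add: M_def field_simps power2_eq_square)
  also have "\<dots> ^ s = (1/2) ^ s * (real s ^ s / (exp 1 ^ s * q ^ s))"
    by (simp only: power_mult_distrib power_divide)
  also have "\<dots> \<le> (1/2) ^ s * (fact s * exp 1 ^ m / (exp 1 ^ s * q ^ s))"
    using S \<open>q > 0\<close> by (intro mult_left_mono divide_right_mono) auto
  also have "\<dots> = (1/2) ^ s * (fact s / (exp 1 * q ^ s))"
    using m by simp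
  finally have "real ((t + s) choose t) * (q / r) ^ s
      \<le> real ((t + s) choose t) * ((1/2) ^ s * (fact s / (exp 1 * q ^ s)))"
    by (intro mult_left_mono) auto
  also have "\<dots> = (1/2) ^ s / exp 1 * (real ((t + s) choose t) * fact s / q ^ s)"
    by simp
  also have "\<dots> \<le> (1/2) ^ s / exp 1 * 1"
    using C \<open>q > 0\<close> by (intro mult_left_mono) auto
  finally show ?thesis by (simp add: q_def)
qed

lemma spread_ratio_le:
  assumes "1 \<le> t" "t < k"
    and r: "2 * exp 1 * max ((real t + 2)\<^sup>2) (real k / (1 - real t / real k)) \<le> r"
  shows "2 * exp 1 * real k \<le> r" "16 / 3 * (real t + 2)\<^sup>2 \<le> r"
proof -
  have "real k \<le> real k / (1 - real t / real k)"
    using assms by (simp add: field_simps)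
  then have "real k \<le> max ((real t + 2)\<^sup>2) (real k / (1 - real t / real k))" by linarith
  then have "2 * exp 1 * real k \<le> 2 * exp 1 * max ((real t + 2)\<^sup>2) (real k / (1 - real t / real k))"
    by (intro mult_left_mono) auto
  with r show "2 * exp 1 * real k \<le> r" by (rule order_trans[rotated])
  have "16 / 3 * (real t + 2)\<^sup>2 \<le> 2 * exp 1 * max ((real t + 2)\<^sup>2) (real k / (1 - real t / real k))"
    using exp_one_ge by (intro mult_mono) auto
  then show "16 / 3 * (real t + 2)\<^sup>2 \<le> r" using r by simp
qed

text \<open>Weight of a whole family times that of the top layer of the other one. Once the
  geometric sum is bounded by a multiple of \<open>x ^ u\<close>, the powers can be exchanged:
  \<open>x ^ s\<close> is paired with the coefficient of \<open>t + s\<close>, \<open>x ^ u\<close>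
  with that of \<open>t + u\<close>.\<close>

lemma mixed_weight:
  assumes "1 \<le> s" "t + s \<le> k" "1 \<le> t" "u \<le> s"
    and r: "2 * exp 1 * max ((real t + 2)\<^sup>2) (real k / (1 - real t / real k)) \<le> r"
  defines "x \<equiv> real (t + s) / r"
  shows "real ((t + s) choose t) * (\<Sum>i\<in>{u..s}. x ^ i) * (real ((t + u) choose t) * x ^ s) \<le> (1/2) ^ s / 2"
proof -
  note bounds = spread_ratio_le[OF _ _ r]
  have "16 / 3 * real k \<le> 2 * exp 1 * real k"
    using exp_one_ge by (intro mult_right_mono) auto
  then have rk: "16 / 3 * real k \<le> r"
    using bounds(1) assms(1-3) by linarith
  then have r0: "r > 0"
    using assms by (smt (verit) mult_pos_pos of_nat_0_less_iff le_add1 less_le_trans zero_less_one divide_pos_pos)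
  have x: "0 \<le> x" "x \<le> 3 / 16"
    using assms rk r0 by (auto simp: x_def field_simps)
  define P where "P = real ((t + s) choose t) * x ^ s"
  define Q where "Q = real ((t + u) choose t) * x ^ u"
  have "(1 - x) * (\<Sum>i\<in>{u..s}. x ^ i) \<le> x ^ u"
    using sum_gp_multiplied[of u s x] assms(4) x by simp
  moreover have "13/16 * (\<Sum>i\<in>{u..s}. x ^ i) \<le> (1 - x) * (\<Sum>i\<in>{u..s}. x ^ i)"
    using x by (intro mult_right_mono sum_nonneg) auto
  ultimately have gp: "(\<Sum>i\<in>{u..s}. x ^ i) \<le> 16/13 * x ^ u" by simp
  have "real ((t + s) choose t) * (\<Sum>i\<in>{u..s}. x ^ i) * (real ((t + u) choose t) * x ^ s)
      \<le> real ((t + s) choose t) * (16/13 * x ^ u) * (real ((t + u) choose t) * x ^ s)"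
    using x by (intro mult_right_mono mult_left_mono gp) auto
  also have "\<dots> = 16/13 * P * Q"
    by (simp add: P_def Q_def)
  \<comment> \<open>If \<open>(t + 1) x \<le> 1\<close>, then \<open>Q \<le> 1\<close>; otherwise \<open>s\<close> is so large compared with \<open>t\<close> that
    exponential bounds on the binomial coefficients suffice.\<close>
  also have "\<dots> \<le> (1/2) ^ s / 2"
  proof (cases "real (Suc t) * x \<le> 1")
    case True
    have "Q \<le> real (Suc t ^ u) * x ^ u"
      unfolding Q_def using x binomial_le_power[of t u] by (intro mult_right_mono) (simp_all only: of_nat_le_iff zero_le_power)
    also have "\<dots> = (real (Suc t) * x) ^ u"
      by (simp only: of_nat_power power_mult_distrib)
    also have "\<dots> \<le> 1"
      using True x by (intro power_le_one) auto
    finally have "Q \<le> 1" .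
    have "P \<le> (1/2) ^ s / exp 1"
      unfolding P_def x_def using top_layer_weight[OF assms(1-3) r] .
    also have "\<dots> \<le> (1/2) ^ s / (8/3)"
      using exp_one_ge by (intro divide_left_mono) auto
    finally have "P \<le> (1/2) ^ s / (8/3)" .
    \<comment> \<open>\<open>16/13 * 3/8 = 6/13\<close>, just below \<open>1/2\<close>.\<close>
    then have "16/13 * P * Q \<le> 16/13 * ((1/2) ^ s / (8/3)) * 1"
      using x \<open>Q \<le> 1\<close> by (intro mult_mono) (auto simp: P_def Q_def)
    also have "\<dots> \<le> (1/2) ^ s / 2" by simp
    finally show ?thesis .
  next
    case False
    then have "r < real (Suc t) * real (t + s)"
      using r0 by (simp add: x_def field_simps)
    also have "\<dots> \<le> (real t + 2) * real (t + s)"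
      by (intro mult_right_mono) auto
    \<comment> \<open>The upper bound on \<open>r\<close> from the case assumption meets the lower
      bound \<open>16/3 * (t + 2)^2\<close> from the threshold.\<close>
    finally have "(real t + 2) * (16/3 * (real t + 2)) < (real t + 2) * real (t + s)"
      using bounds(2) assms by (simp add: power2_eq_square algebra_simps)
    then have "16/3 * (real t + 2) < real (t + s)"
      by (subst (asm) mult_less_cancel_left_pos) auto
    then have "real (4 * t + 10) \<le> real s" by simp
    then have s: "4 * t + 10 \<le> s" by (simp only: of_nat_le_iff)
    have "real ((t + s) choose t) * (1/2) ^ s * (1/2) ^ t \<le> 1"
      using binomial_term_le_one[of "1/2" t s] by simp
    then have "real ((t + s) choose t) \<le> 2 ^ s * 2 ^ t"
      by (simp add: field_simps)
    then have "P \<le> (2 ^ s * 2 ^ t) * (3/16) ^ s"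
      unfolding P_def using x by (intro mult_mono power_mono) auto
    also have "\<dots> = (1/2) ^ s * ((3/4) ^ s * 2 ^ t)"
    proof -
      have "(2::real) * (3/16) = (1/2) * (3/4)" by simp
      then have "(2::real) ^ s * (3/16) ^ s = (1/2) ^ s * (3/4) ^ s"
        by (simp only: flip: power_mult_distrib)
      then show ?thesis by simp
    qed
    also have "\<dots> \<le> (1/2) ^ s * ((3/4) ^ (4 * t + 10) * 2 ^ t)"
      using s by (intro mult_left_mono mult_right_mono power_decreasing) auto
    finally have P: "P \<le> (1/2) ^ s * ((3/4) ^ (4 * t + 10) * 2 ^ t)" .
    have "Q * (13/16) ^ t \<le> Q * (1 - x) ^ t"
      using x by (intro mult_left_mono power_mono) (auto simp: Q_def)
    also have "\<dots> \<le> 1"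
      unfolding Q_def using x binomial_term_le_one[of x t u] by auto
    finally have Q: "Q \<le> (16/13) ^ t"
      by (simp add: field_simps)
    have "16/13 * P * Q \<le> 16/13 * ((1/2) ^ s * ((3/4) ^ (4 * t + 10) * 2 ^ t)) * (16/13) ^ t"
      using P Q x by (intro mult_mono) (auto simp: P_def Q_def)
    also have "\<dots> = (1/2) ^ s * (16/13 * (3/4) ^ 10) * (((3/4) ^ 4) ^ t * 2 ^ t * (16/13) ^ t)"
      by (simp add: power_add power_mult)
    \<comment> \<open>In \<open>4 * t + 10 \<le> s\<close>, the part \<open>4 * t\<close> outweighs
      all powers with exponent \<open>t\<close>, since \<open>(3/4)^4 * 2 * 16/13 = 81/104\<close>;
      the part \<open>10\<close> absorbs the constant \<open>16/13\<close>.\<close>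
    also have "((3/4::real) ^ 4) ^ t * 2 ^ t * (16/13) ^ t = (81/104) ^ t"
      unfolding power_mult_distrib[symmetric] by (simp add: power4_eq_xxxx)
    also have "(1/2) ^ s * (16/13 * (3/4) ^ 10) * (81/104) ^ t \<le> (1/2) ^ s * (1/2) * (1::real)"
      by (intro mult_mono power_le_one) (simp_all add: eval_nat_numeral)
    finally show ?thesis by simp
  qed
  finally show ?thesis .
qed

section \<open>Families through a common \<open>t\<close>-set\<close>

text \<open>\<open>X\<close> meets \<open>W\<close> in fewer than \<open>t\<close> elements, so
  every \<open>T\<close> contains \<open>X\<close> and a further element \<open>y\<close> of
  \<open>W - X\<close>. There are at most \<open>card W\<close> sets \<open>insert y X\<close>, and
  each has degree at most the extremal value divided by \<open>r\<close>.\<close>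

lemma card_above_through_common:
  assumes "finite \<Omega>" "\<A> \<subseteq> Pow \<Omega>" "weakly_spread \<Omega> r t \<A>" "0 < r"
    and X: "X \<in> nsets \<Omega> t" and W: "W \<subseteq> \<Omega>" "\<not> X \<subseteq> W"
    and T: "\<And>T. T \<in> \<T> \<Longrightarrow> X \<subseteq> T \<and> t \<le> card (T \<inter> W)"
  shows "real (card (above \<A> \<T>)) \<le> real (card W) / r * real (max_degree \<Omega> t \<A>)"
    and "T \<in> \<T> \<Longrightarrow> finite T \<Longrightarrow> t < card T"
proof -
  have finX: "finite X" "card X = t" "X \<subseteq> \<Omega>"
    using X by (auto simp: nsets_def)
  have finW: "finite W" using W(1) assms(1) finite_subset by metis
  have "card (X \<inter> W) < t"
    using W(2) finX psubset_card_mono[of X "X \<inter> W"] by auto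
  then have meet: "T \<inter> (W - X) \<noteq> {}" if "T \<in> \<T>" for T
    using diff_Int_nonempty[of X W t T] T[OF that] finX(1) by auto
  show "t < card T" if "T \<in> \<T>" "finite T"
    using meet[OF that(1)] T[OF that(1)] finX(2) psubset_card_mono[of T X] that(2) by auto
  define \<W> where "\<W> = (\<lambda>y. insert y X) ` (W - X)"
  have "\<W> \<subseteq> nsets \<Omega> (t + 1)"
    using finX W(1) by (auto simp: \<W>_def nsets_def)
  then have "real (card (above \<A> \<W>)) \<le> real (card \<W>) * (real (max_degree \<Omega> t \<A>) / r ^ 1)"
    by (rule card_above_uniform[OF assms(1-3)])
  also have "\<dots> \<le> real (card W) * (real (max_degree \<Omega> t \<A>) / r ^ 1)"
  proof (intro mult_right_mono)
    have "card \<W> \<le> card (W - X)"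
      unfolding \<W>_def using finW by (intro card_image_le) auto
    also have "\<dots> \<le> card W"
      using finW by (intro card_mono) auto
    finally show "real (card \<W>) \<le> real (card W)" by simp
  qed (use assms(4) in auto)
  finally have "real (card (above \<A> \<W>)) \<le> real (card W) / r * real (max_degree \<Omega> t \<A>)" by simp
  moreover have "above \<A> \<T> \<subseteq> above \<A> \<W>"
  proof
    fix A assume "A \<in> above \<A> \<T>"
    then obtain T' where T': "A \<in> \<A>" "T' \<in> \<T>" "T' \<subseteq> A"
      by (auto simp: above_def)
    then obtain y where "y \<in> T'" "y \<in> W - X"
      using meet by blast
    then have "insert y X \<in> \<W>" "insert y X \<subseteq> A"
      using T[OF T'(2)] T'(3) by (auto simp: \<W>_def)
    then show "A \<in> above \<A> \<W>"
      using T'(1) unfolding above_def by blast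
  qed
  moreover have "finite (above \<A> \<W>)"
    using above_subset[of \<A> \<W>] assms(1,2) finite_subset finite_Pow_iff by metis
  ultimately show "real (card (above \<A> \<T>)) \<le> real (card W) / r * real (max_degree \<Omega> t \<A>)"
    using card_mono[of "above \<A> \<W>" "above \<A> \<T>"] by linarith
qed

section \<open>Peeling a cross-intersecting pair\<close>

lemma card_above_le_sum_layers:
  assumes "finite \<A>" "\<And>U. U \<in> \<U> \<Longrightarrow> finite U \<and> t + u \<le> card U \<and> card U \<le> t + s"
  shows "real (card (above \<A> \<U>)) \<le> (\<Sum>i\<in>{u..s}. real (card (above \<A> (layer \<U> (t + i)))))"
proof -
  have "finite (above \<A> \<T>)" for \<T>
    using finite_subset[OF above_subset assms(1)] .
  then have "card (above \<A> \<U>) \<le> card (\<Union>i\<in>{u..s}. above \<A> (layer \<U> (t + i)))"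
    using above_subset_layers[OF assms(2)] by (intro card_mono) auto
  also have "\<dots> \<le> (\<Sum>i\<in>{u..s}. card (above \<A> (layer \<U> (t + i))))"
    by (intro card_UN_le) auto
  finally show ?thesis
    by (simp only: of_nat_le_iff flip: of_nat_sum)
qed

lemma card_above_le_top_layer:
  assumes "finite \<A>" "\<And>U. U \<in> \<U> \<Longrightarrow> finite U \<and> card U \<le> Suc m"
  shows "real (card (above \<A> \<U>)) \<le>
    real (card (above \<A> {U \<in> \<U>. card U \<le> m})) + real (card (above \<A> (layer \<U> (Suc m))))"
proof -
  have "finite (above \<A> \<T>)" for \<T>
    using finite_subset[OF above_subset assms(1)] .
  then have "card (above \<A> \<U>) \<le>
      card (above \<A> {U \<in> \<U>. card U \<le> m} \<union> above \<A> (layer \<U> (Suc m)))"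
    using above_subset_top_layer[OF assms(2)] by (intro card_mono) auto
  also have "\<dots> \<le> card (above \<A> {U \<in> \<U>. card U \<le> m}) + card (above \<A> (layer \<U> (Suc m)))"
    by (rule card_Un_le)
  finally show ?thesis by linarith
qed

lemma card_above_layer_cross:
  assumes fin: "finite \<Omega>" and A: "\<A> \<subseteq> Pow \<Omega>" "weakly_spread \<Omega> r t \<A>" and r: "0 < r"
    and sub: "\<U> \<subseteq> Pow \<Omega>" "\<V> \<subseteq> Pow \<Omega>"
    and cross: "cross_t_intersecting t \<U> \<V>"
    and sat: "\<And>Y. Y \<subseteq> \<Omega> \<Longrightarrow> card Y \<le> c \<Longrightarrow> (\<And>V. V \<in> \<V> \<Longrightarrow> t \<le> card (Y \<inter> V)) \<Longrightarrow> Y \<in> \<U>"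
    and small: "\<And>U. U \<in> \<U> \<Longrightarrow> card U \<le> c" "\<And>V. V \<in> \<V> \<Longrightarrow> card V \<le> c"
    and V1: "V1 \<in> \<V>"
  shows "real (card (above \<A> (layer \<U> (t + i))))
    \<le> real (card V1 choose t) * (real c / r) ^ i * real (max_degree \<Omega> t \<A>)"
proof -
  have "layer \<U> (t + i) \<subseteq> nsets \<Omega> (t + i)"
  proof
    fix W assume "W \<in> layer \<U> (t + i)"
    then have "W \<subseteq> \<Omega>" "card W = t + i"
      using sub(1) by (auto simp: layer_def)
    then show "W \<in> nsets \<Omega> (t + i)"
      using finite_subset[OF _ fin] by (simp add: nsets_def)
  qed
  then have "real (card (above \<A> (layer \<U> (t + i))))
      \<le> real (card (layer \<U> (t + i))) * (real (max_degree \<Omega> t \<A>) / r ^ i)"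
    by (rule card_above_uniform[OF fin A])
  also have "\<dots> \<le> real ((card V1 choose t) * c ^ i) * (real (max_degree \<Omega> t \<A>) / r ^ i)"
    using card_layer_cross[OF fin sub cross sat small V1, where n = "t + i"] r
    by (intro mult_right_mono) (simp_all only: of_nat_le_iff, simp_all)
  finally show ?thesis by (simp add: power_divide)
qed

text \<open>
  The branching starts from a smallest member of the other family, so the bound on the number of
  minimal sets in \<open>\<U>\<close> grows with the smallest size in \<open>\<V>\<close>, and conversely. Neither factor is
  bounded by its extremal value alone, but in the product the two effects compensate.
\<close>

lemma cross_peel:
  fixes t s k :: nat and r :: real
  assumes fin: "finite \<Omega>" and A: "\<A> \<subseteq> Pow \<Omega>" "weakly_spread \<Omega> r t \<A>"
    and B: "\<B> \<subseteq> Pow \<Omega>" "weakly_spread \<Omega> r t \<B>"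
    and t: "1 \<le> t" and s: "t + Suc s \<le> k"
    and r: "2 * exp 1 * max ((real t + 2)\<^sup>2) (real k / (1 - real t / real k)) \<le> r"
    and sub: "\<U> \<subseteq> Pow \<Omega>" "\<V> \<subseteq> Pow \<Omega>"
    and cross: "cross_t_intersecting t \<U> \<V>"
    and satU: "\<And>Y. Y \<subseteq> \<Omega> \<Longrightarrow> card Y \<le> t + Suc s \<Longrightarrow> (\<And>V. V \<in> \<V> \<Longrightarrow> t \<le> card (Y \<inter> V)) \<Longrightarrow> Y \<in> \<U>"
    and satV: "\<And>Y. Y \<subseteq> \<Omega> \<Longrightarrow> card Y \<le> t + Suc s \<Longrightarrow> (\<And>U. U \<in> \<U> \<Longrightarrow> t \<le> card (Y \<inter> U)) \<Longrightarrow> Y \<in> \<V>"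
    and small: "\<And>U. U \<in> \<U> \<Longrightarrow> card U \<le> t + Suc s" "\<And>V. V \<in> \<V> \<Longrightarrow> card V \<le> t + Suc s"
    and ne: "\<U> \<noteq> {}" "\<V> \<noteq> {}"
  defines "a \<equiv> real (max_degree \<Omega> t \<A>)" and "b \<equiv> real (max_degree \<Omega> t \<B>)"
  shows "real (card (above \<A> \<U>)) * real (card (above \<B> \<V>))
    \<le> real (card (above \<A> {U \<in> \<U>. card U \<le> t + s})) * real (card (above \<B> {V \<in> \<V>. card V \<le> t + s}))
      + (1/2) ^ Suc s * (a * b)"
proof -
  define x where "x = real (t + Suc s) / r"
  have "t < k" using s by simp
  have "0 < 16 / 3 * (real t + 2)\<^sup>2" by (simp add: add_nonneg_pos)
  then have r0: "0 < r"
    using spread_ratio_le(2)[OF t \<open>t < k\<close> r] by linarith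
  have x0: "0 \<le> x" using r0 by (simp add: x_def)
  have fins: "finite Y" if "Y \<subseteq> \<Omega>" for Y
    using that fin finite_subset by metis
  have finF: "finite \<A>" "finite \<B>"
    using A(1) B(1) fin finite_subset finite_Pow_iff by metis+
  then have finB: "finite (above \<B> \<T>)" for \<T>
    using finite_subset[OF above_subset] by metis
  have cross': "cross_t_intersecting t \<V> \<U>"
    using cross by (metis cross_t_intersecting_def Int_commute)
  obtain U1 where U1: "U1 \<in> \<U>" "\<And>U. U \<in> \<U> \<Longrightarrow> card U1 \<le> card U"
    using ne(1) exists_least_iff[of "\<lambda>n. \<exists>U\<in>\<U>. card U = n"] by (metis all_not_in_conv not_le)
  obtain V1 where V1: "V1 \<in> \<V>" "\<And>V. V \<in> \<V> \<Longrightarrow> card V1 \<le> card V"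
    using ne(2) exists_least_iff[of "\<lambda>n. \<exists>V\<in>\<V>. card V = n"] by (metis all_not_in_conv not_le)
  have UV: "t \<le> card (U1 \<inter> V1)"
    using U1 V1 cross by (auto simp: cross_t_intersecting_def)
  have "card (U1 \<inter> V1) \<le> card U1" "card (U1 \<inter> V1) \<le> card V1"
    using U1 V1 sub fins by (auto intro!: card_mono)
  then obtain u v where u: "card U1 = t + u" and v: "card V1 = t + v"
    using UV by (metis le_Suc_ex le_trans)
  have us: "u \<le> Suc s" and vs: "v \<le> Suc s"
    using small(1)[OF U1(1)] small(2)[OF V1(1)] u v by auto
  have layA: "real (card (above \<A> (layer \<U> (t + i)))) \<le> real ((t + v) choose t) * x ^ i * a" for i
    unfolding x_def a_def v[symmetric]
    by (rule card_above_layer_cross[OF fin A r0 sub cross satU small V1(1)])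
  have layB: "real (card (above \<B> (layer \<V> (t + i)))) \<le> real ((t + u) choose t) * x ^ i * b" for i
    unfolding x_def b_def u[symmetric]
    by (rule card_above_layer_cross[OF fin B r0 sub(2,1) cross' satV small(2,1) U1(1)])
  \<comment> \<open>Members of \<open>\<U>\<close> have size at least \<open>t + u\<close>, so its
    layers start at index \<open>u\<close>. The coefficient has \<open>v\<close> because the search
    starts in \<open>V1\<close>.\<close>
  have totA: "real (card (above \<A> \<U>)) \<le> real ((t + v) choose t) * (\<Sum>i\<in>{u..Suc s}. x ^ i) * a"
  proof -
    have "real (card (above \<A> \<U>)) \<le> (\<Sum>i\<in>{u..Suc s}. real (card (above \<A> (layer \<U> (t + i)))))"
      using U1(2) small(1) sub(1) fins u finF by (intro card_above_le_sum_layers) auto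
    also have "\<dots> \<le> (\<Sum>i\<in>{u..Suc s}. real ((t + v) choose t) * x ^ i * a)"
      by (intro sum_mono layA)
    finally show ?thesis by (simp only: sum_distrib_left sum_distrib_right)
  qed
  have totB: "real (card (above \<B> \<V>)) \<le> real ((t + u) choose t) * (\<Sum>i\<in>{v..Suc s}. x ^ i) * b"
  proof -
    have "real (card (above \<B> \<V>)) \<le> (\<Sum>i\<in>{v..Suc s}. real (card (above \<B> (layer \<V> (t + i)))))"
      using V1(2) small(2) sub(2) fins v finF by (intro card_above_le_sum_layers) auto
    also have "\<dots> \<le> (\<Sum>i\<in>{v..Suc s}. real ((t + u) choose t) * x ^ i * b)"
      by (intro sum_mono layB)
    finally show ?thesis by (simp only: sum_distrib_left sum_distrib_right)
  qed
  define f where "f = real (card (above \<A> \<U>))"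
  define g where "g = real (card (above \<B> \<V>))"
  define f' where "f' = real (card (above \<A> {U \<in> \<U>. card U \<le> t + s}))"
  define g' where "g' = real (card (above \<B> {V \<in> \<V>. card V \<le> t + s}))"
  define p where "p = real (card (above \<A> (layer \<U> (t + Suc s))))"
  define q where "q = real (card (above \<B> (layer \<V> (t + Suc s))))"
  have fp: "f \<le> f' + p"
    unfolding f_def f'_def p_def add_Suc_right
    using small(1) sub(1) fins finF by (intro card_above_le_top_layer) auto
  have gq: "g \<le> g' + q"
    unfolding g_def g'_def q_def add_Suc_right
    using small(2) sub(2) fins finF by (intro card_above_le_top_layer) auto
  have g'g: "g' \<le> g"
    unfolding g'_def g_def using finB by (intro of_nat_mono card_mono above_mono) auto
  have nonneg: "0 \<le> a" "0 \<le> b" "0 \<le> f" "0 \<le> g" "0 \<le> g'" "0 \<le> p" "0 \<le> q"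
    by (simp_all add: a_def b_def f_def g_def g'_def p_def q_def)
  have mono_choose: "real ((t + w) choose t) \<le> real ((t + Suc s) choose t)" if "w \<le> Suc s" for w
    using that by (intro of_nat_mono binomial_right_mono) auto
  have fq: "f * q \<le> (1/2) ^ Suc s / 2 * (a * b)"
  proof -
    have "f * q \<le> (real ((t + v) choose t) * (\<Sum>i\<in>{u..Suc s}. x ^ i) * a)
        * (real ((t + u) choose t) * x ^ Suc s * b)"
      using totA layB[of "Suc s"] nonneg x0 unfolding f_def q_def
      by (intro mult_mono mult_nonneg_nonneg sum_nonneg) auto
    also have "\<dots> = real ((t + v) choose t) * ((\<Sum>i\<in>{u..Suc s}. x ^ i)
        * (real ((t + u) choose t) * x ^ Suc s)) * (a * b)"
      by (simp only: mult_ac)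
    \<comment> \<open>Only the coefficient with \<open>v\<close> is enlarged. The one with
      \<open>u\<close> is kept, to be offset by the power \<open>x ^ u\<close> that leads the
      geometric sum.\<close>
    also have "\<dots> \<le> real ((t + Suc s) choose t) * ((\<Sum>i\<in>{u..Suc s}. x ^ i)
        * (real ((t + u) choose t) * x ^ Suc s)) * (a * b)"
      using mono_choose[OF vs] x0 nonneg
      by (intro mult_right_mono mult_nonneg_nonneg sum_nonneg) auto
    also have "\<dots> \<le> (1/2) ^ Suc s / 2 * (a * b)"
      using mixed_weight[OF _ s t us r, folded x_def] nonneg
      by (intro mult_right_mono) (simp_all add: mult.assoc)
    finally show ?thesis .
  qed
  have pg: "p * g \<le> (1/2) ^ Suc s / 2 * (a * b)"
  proof -
    have "g * p \<le> (real ((t + u) choose t) * (\<Sum>i\<in>{v..Suc s}. x ^ i) * b)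
        * (real ((t + v) choose t) * x ^ Suc s * a)"
      using totB layA[of "Suc s"] nonneg x0 unfolding g_def p_def
      by (intro mult_mono mult_nonneg_nonneg sum_nonneg) auto
    also have "\<dots> = real ((t + u) choose t) * ((\<Sum>i\<in>{v..Suc s}. x ^ i)
        * (real ((t + v) choose t) * x ^ Suc s)) * (a * b)"
      by (simp only: mult_ac)
    also have "\<dots> \<le> real ((t + Suc s) choose t) * ((\<Sum>i\<in>{v..Suc s}. x ^ i)
        * (real ((t + v) choose t) * x ^ Suc s)) * (a * b)"
      using mono_choose[OF us] x0 nonneg
      by (intro mult_right_mono mult_nonneg_nonneg sum_nonneg) auto
    also have "\<dots> \<le> (1/2) ^ Suc s / 2 * (a * b)"
      using mixed_weight[OF _ s t vs r, folded x_def] nonneg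
      by (intro mult_right_mono) (simp_all add: mult.assoc)
    finally show ?thesis by (simp only: mult.commute)
  qed
  \<comment> \<open>The two mixed products \<open>f * q\<close> and \<open>p * g\<close> use up one
    half of the permitted loss each.\<close>
  have "f * g \<le> f * g' + f * q"
    using gq nonneg by (metis distrib_left mult_left_mono)
  also have "f * g' \<le> (f' + p) * g'"
    using fp nonneg by (intro mult_right_mono)
  also have "(f' + p) * g' \<le> f' * g' + p * g"
    using g'g nonneg by (simp add: distrib_right mult_left_mono)
  finally have "f * g \<le> f' * g' + (1/2) ^ Suc s * (a * b)"
    using fq pg by simp
  then show ?thesis unfolding f_def g_def f'_def g'_def .
qed

lemma card_le_max_degree_if_common_subset:
  assumes "finite \<Omega>" "\<A> \<subseteq> Pow \<Omega>" "X \<in> nsets \<Omega> t" "\<F> \<subseteq> \<A>" "\<forall>F\<in>\<F>. X \<subseteq> F"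
  shows "card \<F> \<le> max_degree \<Omega> t \<A>"
    and "card \<F> = max_degree \<Omega> t \<A> \<Longrightarrow>
      \<F> = containing \<A> X \<and> card (containing \<A> X) = max_degree \<Omega> t \<A>"
proof -
  have sub: "\<F> \<subseteq> containing \<A> X"
    using assms(4,5) by (auto simp: containing_def)
  have fin: "finite (containing \<A> X)"
    using finite_subset[OF assms(2)] assms(1) by (simp add: containing_def)
  have "card \<F> \<le> card (containing \<A> X)"
    using card_mono[OF fin sub] .
  moreover note le = card_containing_le_max_degree[OF assms(1,3), of \<A>]
  ultimately show "card \<F> \<le> max_degree \<Omega> t \<A>" by simp
  show "\<F> = containing \<A> X \<and> card (containing \<A> X) = max_degree \<Omega> t \<A>"
    if "card \<F> = max_degree \<Omega> t \<A>"
    using card_seteq[OF fin sub] le that by auto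
qed

text \<open>Induction on \<open>s\<close>, one peeling per step: the permitted loss
  \<open>(1/2) ^ Suc s\<close> is exactly the difference of consecutive bounds. For
  \<open>s = 0\<close> cross-intersection forces all sets to be one and the same
  \<open>t\<close>-set, unless a family is empty.\<close>

lemma no_common_subset_bound_cross:
  fixes t s k :: nat and r :: real
  assumes fin: "finite \<Omega>" and A: "\<A> \<subseteq> Pow \<Omega>" "weakly_spread \<Omega> r t \<A>"
    and B: "\<B> \<subseteq> Pow \<Omega>" "weakly_spread \<Omega> r t \<B>"
    and t: "1 \<le> t" and "t < k"
    and r: "2 * exp 1 * max ((real t + 2)\<^sup>2) (real k / (1 - real t / real k)) \<le> r"
    and "t + s \<le> k" "\<S> \<subseteq> Pow \<Omega>" "\<T> \<subseteq> Pow \<Omega>"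
    and "\<And>Y. Y \<in> \<S> \<union> \<T> \<Longrightarrow> card Y \<le> t + s"
    and "cross_t_intersecting t \<S> \<T>"
    and "\<not> (\<exists>X\<in>nsets \<Omega> t. \<forall>Y\<in>\<S> \<union> \<T>. X \<subseteq> Y)"
  shows "real (card (above \<A> \<S>)) * real (card (above \<B> \<T>))
    \<le> (1 - (1/2) ^ s) * (real (max_degree \<Omega> t \<A>) * real (max_degree \<Omega> t \<B>))"
  using assms(9-)
proof (induction s arbitrary: \<S> \<T>)
  case 0
  have fins: "finite Y" if "Y \<in> \<S> \<union> \<T>" for Y
    using that "0.prems"(2,3) finite_subset[OF _ fin] by auto
  have "\<S> = {} \<or> \<T> = {}"
  proof (rule ccontr)
    assume "\<not> (\<S> = {} \<or> \<T> = {})"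
    then obtain S T where ST: "S \<in> \<S>" "T \<in> \<T>" by auto
    have eq: "S' = T' \<and> card S' = t" if "S' \<in> \<S>" "T' \<in> \<T>" for S' T'
    proof -
      have c: "t \<le> card (S' \<inter> T')"
        using that "0.prems"(5) by (auto simp: cross_t_intersecting_def)
      have "finite S'" "finite T'" "card S' \<le> t" "card T' \<le> t"
        using that fins "0.prems"(4) by auto
      then have "S' \<inter> T' = S'" "S' \<inter> T' = T'"
        using c card_seteq[of S' "S' \<inter> T'"] card_seteq[of T' "S' \<inter> T'"] by auto
      then show ?thesis using c that "0.prems"(4)[of S'] by auto
    qed
    have "S \<in> nsets \<Omega> t"
      using ST eq[OF ST] fins[of S] "0.prems"(2) by (auto simp: nsets_def)
    moreover have "\<forall>Y\<in>\<S> \<union> \<T>. S \<subseteq> Y"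
      using ST eq by blast
    ultimately show False using "0.prems"(6) by blast
  qed
  then show ?case by (auto simp: above_def)
next
  case (Suc s)
  define a where "a = real (max_degree \<Omega> t \<A>)"
  define b where "b = real (max_degree \<Omega> t \<B>)"
  \<comment> \<open>One round of closure saturates both sides: \<open>\<V>\<close> is defined from
    \<open>\<U>\<close>, and a small set meeting all of \<open>\<V>\<close> in at least
    \<open>t\<close> elements meets all of \<open>\<T>\<close> so, because \<open>\<T>\<close> lies
    in \<open>\<V>\<close>.\<close>
  define \<U> where "\<U> = {Y. Y \<subseteq> \<Omega> \<and> card Y \<le> t + Suc s \<and> (\<forall>T\<in>\<T>. t \<le> card (Y \<inter> T))}"
  define \<V> where "\<V> = {Y. Y \<subseteq> \<Omega> \<and> card Y \<le> t + Suc s \<and> (\<forall>U\<in>\<U>. t \<le> card (Y \<inter> U))}"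
  define \<U>' where "\<U>' = {U \<in> \<U>. card U \<le> t + s}"
  define \<V>' where "\<V>' = {V \<in> \<V>. card V \<le> t + s}"
  have ab: "0 \<le> a * b" by (simp add: a_def b_def)
  have half: "(1/2) ^ s \<le> (1::real)" for s :: nat by (intro power_le_one) auto
  have fins: "finite Y" if "Y \<subseteq> \<Omega>" for Y
    using that fin finite_subset by metis
  have finA: "finite (above \<A> \<T>)" and finB: "finite (above \<B> \<T>)" for \<T>
    using above_subset[of _ \<T>] A(1) B(1) fin by (meson finite_Pow_iff finite_subset)+
  have SU: "\<S> \<subseteq> \<U>"
    using Suc.prems(2,4,5) by (auto simp: \<U>_def cross_t_intersecting_def)
  have TV: "\<T> \<subseteq> \<V>"
    using Suc.prems(3,4) by (auto simp: \<V>_def \<U>_def Int_commute)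
  have sub: "\<U> \<subseteq> Pow \<Omega>" "\<V> \<subseteq> Pow \<Omega>" by (auto simp: \<U>_def \<V>_def)
  have small: "card U \<le> t + Suc s" if "U \<in> \<U> \<or> U \<in> \<V>" for U
    using that by (auto simp: \<U>_def \<V>_def)
  have cross: "t \<le> card (U \<inter> V)" "t \<le> card (V \<inter> U)" if "U \<in> \<U>" "V \<in> \<V>" for U V
    using that by (auto simp: \<V>_def Int_commute)
  have crossUV: "cross_t_intersecting t \<U> \<V>"
    using cross by (auto simp: cross_t_intersecting_def)
  have "real (card (above \<A> \<S>)) * real (card (above \<B> \<T>))
      \<le> real (card (above \<A> \<U>)) * real (card (above \<B> \<V>))"
    using SU TV finA finB by (intro mult_mono of_nat_mono card_mono above_mono) auto
  also have "\<dots> \<le> (1 - (1/2) ^ Suc s) * (a * b)"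
  proof (cases "\<U> = {} \<or> \<V> = {}")
    case True
    then have "real (card (above \<A> \<U>)) * real (card (above \<B> \<V>)) = 0"
      by (auto simp: above_def)
    then show ?thesis using ab half[of "Suc s"] by (metis diff_ge_0_iff_ge mult_nonneg_nonneg)
  next
    case False
    have rest: "real (card (above \<A> \<U>')) * real (card (above \<B> \<V>')) \<le> (1 - (1/2) ^ s) * (a * b)"
    proof (cases "\<exists>X\<in>nsets \<Omega> t. \<forall>Y\<in>\<U>' \<union> \<V>'. X \<subseteq> Y")
      case nt: False
      show ?thesis
        unfolding a_def b_def
      proof (rule Suc.IH)
        show "cross_t_intersecting t \<U>' \<V>'"
          using cross by (simp add: cross_t_intersecting_def \<U>'_def \<V>'_def)
        show "\<U>' \<subseteq> Pow \<Omega>" "\<V>' \<subseteq> Pow \<Omega>"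
          using sub by (simp_all only: \<U>'_def \<V>'_def subset_iff mem_Collect_eq) blast+
        show "card Y \<le> t + s" if "Y \<in> \<U>' \<union> \<V>'" for Y
          using that by (auto simp: \<U>'_def \<V>'_def)
      qed (use Suc.prems(1) nt in simp_all)
    next
      case True
      then obtain X where X: "X \<in> nsets \<Omega> t" "\<And>Y. Y \<in> \<U>' \<union> \<V>' \<Longrightarrow> X \<subseteq> Y" by blast
      \<comment> \<open>Since the given pair has no common \<open>t\<close>-subset, some original
        set \<open>W\<close> misses part of \<open>X\<close>. It lies in one closure, and the
        remaining sets of the other closure then contain \<open>X\<close> and meet \<open>W\<close>
        outside \<open>X\<close>.\<close>
      obtain W where W': "W \<in> \<S> \<union> \<T>" and notX: "\<not> X \<subseteq> W"
        using Suc.prems(6) X(1) by metis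
      have W: "W \<in> \<U> \<union> \<V>" "\<not> X \<subseteq> W"
        using notX W' SU TV by auto
      have WO: "W \<subseteq> \<Omega>" "card W \<le> t + Suc s"
        using W(1) sub small by auto
      have rk: "2 * exp 1 * real k \<le> r"
        using spread_ratio_le(1)[OF t \<open>t < k\<close> r] .
      have "16/3 * real k \<le> 2 * exp 1 * real k"
        using exp_one_ge by (intro mult_right_mono) auto
      then have rk: "2 * real k \<le> r" using rk by linarith
      then have r0: "0 < r" using \<open>t < k\<close> by simp
      have le_one: "real (card (above \<A> \<U>')) \<le> a" "real (card (above \<B> \<V>')) \<le> b"
      proof -
        have "\<forall>Y\<in>above \<A> \<U>'. X \<subseteq> Y" "\<forall>Y\<in>above \<B> \<V>'. X \<subseteq> Y"
          using X(2) unfolding above_def by blast+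
        then show "real (card (above \<A> \<U>')) \<le> a" "real (card (above \<B> \<V>')) \<le> b"
          unfolding a_def b_def of_nat_le_iff
          using card_le_max_degree_if_common_subset(1)[OF fin A(1) X(1) above_subset]
            card_le_max_degree_if_common_subset(1)[OF fin B(1) X(1) above_subset] by blast+
      qed
      define \<epsilon> where "\<epsilon> = real (card W) / r"
      have "card W \<le> k" using WO(2) Suc.prems(1) by linarith
      then have eps: "0 \<le> \<epsilon>" "\<epsilon> \<le> 1/2"
        using rk r0 by (auto simp: \<epsilon>_def field_simps)
      \<comment> \<open>For \<open>s = 0\<close> the bound to be shown is zero, which a factor
        \<open>\<epsilon>\<close> cannot give. There one family is empty, as its members would have
        size at most \<open>t\<close> and more than \<open>t\<close>.\<close>
      have key: "real (card (above \<A> \<U>')) * real (card (above \<B> \<V>')) \<le> \<epsilon> * (a * b) \<and>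
        (s = 0 \<longrightarrow> \<U>' = {} \<or> \<V>' = {})"
      proof (cases "W \<in> \<V>")
        case True
        have *: "X \<subseteq> Y \<and> t \<le> card (Y \<inter> W)" if "Y \<in> \<U>'" for Y
          using that X(2) cross(1)[OF _ True] by (auto simp: \<U>'_def)
        have "real (card (above \<A> \<U>')) \<le> \<epsilon> * a"
          unfolding \<epsilon>_def a_def by (rule card_above_through_common(1)[OF fin A r0 X(1) WO(1) W(2) *])
        then have "real (card (above \<A> \<U>')) * real (card (above \<B> \<V>')) \<le> (\<epsilon> * a) * b"
          using le_one eps by (intro mult_mono) (auto simp: a_def)
        moreover have "t < card Y" if "Y \<in> \<U>'" for Y
          using card_above_through_common(2)[where \<T> = "\<U>'", OF fin A r0 X(1) WO(1) W(2) *] that sub fins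
          by (auto simp: \<U>'_def)
        then have "s = 0 \<longrightarrow> \<U>' = {}"
          by (fastforce simp: \<U>'_def)
        ultimately show ?thesis by (simp add: mult.assoc)
      next
        case False
        then have "W \<in> \<U>" using W(1) by auto
        then have *: "X \<subseteq> Y \<and> t \<le> card (Y \<inter> W)" if "Y \<in> \<V>'" for Y
          using that X(2) cross(2)[of W] by (auto simp: \<V>'_def)
        have "real (card (above \<B> \<V>')) \<le> \<epsilon> * b"
          unfolding \<epsilon>_def b_def by (rule card_above_through_common(1)[OF fin B r0 X(1) WO(1) W(2) *])
        then have "real (card (above \<A> \<U>')) * real (card (above \<B> \<V>')) \<le> a * (\<epsilon> * b)"
          using le_one eps by (intro mult_mono) (auto simp: a_def)
        moreover have "t < card Y" if "Y \<in> \<V>'" for Y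
          using card_above_through_common(2)[where \<T> = "\<V>'", OF fin B r0 X(1) WO(1) W(2) *] that sub fins
          by (auto simp: \<V>'_def)
        then have "s = 0 \<longrightarrow> \<V>' = {}"
          by (fastforce simp: \<V>'_def)
        ultimately show ?thesis by (simp add: mult.left_commute)
      qed
      show ?thesis
      proof (cases "s = 0")
        case True
        then show ?thesis using key by (auto simp: above_def)
      next
        case False
        then have "(1/2) ^ s \<le> (1/2 :: real) ^ 1"
          by (intro power_decreasing) auto
        then have "\<epsilon> * (a * b) \<le> (1 - (1/2) ^ s) * (a * b)"
          using eps ab by (intro mult_right_mono) auto
        with key show ?thesis by linarith
      qed
    qed
    have "real (card (above \<A> \<U>)) * real (card (above \<B> \<V>))
        \<le> real (card (above \<A> \<U>')) * real (card (above \<B> \<V>')) + (1/2) ^ Suc s * (a * b)"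
      unfolding \<U>'_def \<V>'_def a_def b_def
    proof (rule cross_peel[OF fin A B t Suc.prems(1) r sub crossUV])
      show "Y \<in> \<U>" if "Y \<subseteq> \<Omega>" "card Y \<le> t + Suc s" "\<And>V. V \<in> \<V> \<Longrightarrow> t \<le> card (Y \<inter> V)" for Y
        using that TV by (auto simp: \<U>_def)
      show "Y \<in> \<V>" if "Y \<subseteq> \<Omega>" "card Y \<le> t + Suc s" "\<And>U. U \<in> \<U> \<Longrightarrow> t \<le> card (Y \<inter> U)" for Y
        using that by (auto simp: \<V>_def)
    qed (use small False in auto)
    also have "\<dots> \<le> (1 - (1/2) ^ s) * (a * b) + (1/2) ^ Suc s * (a * b)"
      using rest by simp
    also have "\<dots> = (1 - (1/2) ^ Suc s) * (a * b)"
      by (simp add: algebra_simps)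
    finally show ?thesis .
  qed
  finally show ?case unfolding a_def b_def .
qed

section \<open>A single \<open>t\<close>-intersecting family\<close>

text \<open>
  Guess the set \<open>D\<close> of elements that a layer member \<open>W\<close> misses in a fixed layer member \<open>T\<close>. Then
  \<open>W \<inter> T\<close> is known, so the search only adds elements of sets \<open>V - T\<close>, of which there are at
  most \<open>s\<close> instead of \<open>t + s\<close>.
\<close>

lemma card_layer_self:
  assumes fin: "finite \<Omega>" and sub: "\<U> \<subseteq> Pow \<Omega>"
    and int: "t_intersecting t \<U>"
    and sat: "\<And>Y. Y \<subseteq> \<Omega> \<Longrightarrow> t \<le> card Y \<Longrightarrow> card Y \<le> t + s \<Longrightarrow>
      (\<And>V. V \<in> \<U> \<Longrightarrow> t \<le> card (Y \<inter> V)) \<Longrightarrow> Y \<in> \<U>"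
    and small: "\<And>U. U \<in> \<U> \<Longrightarrow> card U \<le> t + s"
  shows "card (layer \<U> (t + s)) \<le> (\<Sum>i\<le>s. ((t + s) choose i) * s ^ i)"
proof (cases "layer \<U> (t + s) = {}")
  case False
  define \<L> where "\<L> = layer \<U> (t + s)"
  obtain T where "T \<in> \<L>" using False by (auto simp: \<L>_def)
  then have T: "T \<in> \<U>" "card T = t + s" by (auto simp: \<L>_def layer_def)
  have finU: "finite U" if "U \<in> \<U>" for U
    using that sub finite_subset[OF _ fin] by auto
  have L: "W \<in> \<U>" "finite W" "card W = t + s" "\<And>X. X \<subset> W \<Longrightarrow> X \<notin> \<U>" if "W \<in> \<L>" for W
    using that finU by (auto simp: \<L>_def layer_def)
  have finL: "finite \<L>"
    using finite_subset[of \<L> "Pow \<Omega>"] sub fin by (auto simp: \<L>_def layer_def)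
  have meet: "t \<le> card (U \<inter> V)" if "U \<in> \<U>" "V \<in> \<U>" for U V
    using int that by (auto simp: t_intersecting_def)
  have each: "card {W \<in> \<L>. W \<inter> T = T - D} \<le> s ^ i" if D: "D \<in> nsets T i" for D i
  proof -
    define \<W> where "\<W> = {W \<in> \<L>. W \<inter> T = T - D}"
    have "card {W \<in> \<W>. T - D \<subseteq> W} \<le> s ^ (t + s - card (T - D))"
    proof (rule card_branching[where X0 = "T - D"])
      fix X W assume X: "T - D \<subseteq> X" "W \<in> \<W>" "X \<subset> W"
      then have W: "W \<in> \<U>" "X \<notin> \<U>" "finite W" "card W = t + s"
        using L[of W] by (auto simp: \<W>_def)
      then have finX: "finite X" "X \<subseteq> \<Omega>" "card X \<le> t + s"
        using X(3) sub finite_subset[of X W] card_mono[of W X] by auto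
      \<comment> \<open>Saturation applies only to sets of size at least \<open>t\<close>. A smaller
        \<open>X\<close> meets its superset \<open>W\<close> in fewer than \<open>t\<close>
        elements, so \<open>W\<close> itself serves as \<open>V\<close>.\<close>
      obtain V where V: "V \<in> \<U>" "card (X \<inter> V) < t"
      proof (cases "t \<le> card X")
        case True
        then show ?thesis using that sat[OF finX(2) True finX(3)] W(2) not_le by metis
      next
        case False
        then show ?thesis using that[OF W(1)] X(3) by (simp add: Int_absorb2 psubset_imp_subset)
      qed
      have "card (V - T) \<le> s"
        using card_Diff_subset_Int[of V T] meet[OF V(1) T(1)] small[OF V(1)] finU[OF V(1)] by simp
      moreover have "((V - T) - X) \<inter> W' \<noteq> {}" if W': "W' \<in> \<W>" "X \<subseteq> W'" for W'
      proof -
        have "(V - X) \<inter> W' \<noteq> {}"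
          using diff_Int_nonempty[OF finX(1) V(2)] meet[OF _ V(1)] W'(1) L(1) by (auto simp: \<W>_def)
        \<comment> \<open>All of \<open>W' \<inter> T = T - D\<close> is in \<open>X\<close> from
          the start, so the new element of \<open>W'\<close> lies in \<open>V - T\<close>.\<close>
        moreover have "W' \<inter> T \<subseteq> X"
          using W'(1) X(1) by (auto simp: \<W>_def)
        ultimately show ?thesis by blast
      qed
      ultimately show "\<exists>Z. finite Z \<and> card Z \<le> s \<and> (\<forall>W'\<in>\<W>. X \<subseteq> W' \<longrightarrow> (Z - X) \<inter> W' \<noteq> {})"
        using finU[OF V(1)] by (intro exI[of _ "V - T"]) simp
    next
      show "finite W \<and> card W = t + s" if "W \<in> \<W>" for W
        using that L(2,3) by (auto simp: \<W>_def)
    qed (use finL finU[OF T(1)] in \<open>auto simp: \<W>_def\<close>)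
    moreover have "{W \<in> \<W>. T - D \<subseteq> W} = \<W>"
      by (auto simp: \<W>_def)
    \<comment> \<open>The start \<open>T - D\<close> lacks \<open>i\<close> elements of the full
      size, so the search has depth \<open>i\<close>.\<close>
    moreover have "card (T - D) = t + s - i" "i \<le> t + s"
      using D T(2) finU[OF T(1)] card_mono[of T D]
      by (auto simp: nsets_def card_Diff_subset)
    ultimately show ?thesis by (simp add: \<W>_def)
  qed
  have fT: "finite T" using finU T(1) .
  have "\<L> \<subseteq> (\<Union>i\<le>s. \<Union>D\<in>nsets T i. {W \<in> \<L>. W \<inter> T = T - D})"
  proof
    fix W assume W: "W \<in> \<L>"
    have "card (T - W) \<le> s"
      using card_Diff_subset_Int[of T W] meet[OF T(1) L(1)[OF W]] T(2) fT by simp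
    moreover have "T - W \<in> nsets T (card (T - W))"
      using fT by (auto simp: nsets_def)
    moreover have "W \<inter> T = T - (T - W)" by auto
    ultimately show "W \<in> (\<Union>i\<le>s. \<Union>D\<in>nsets T i. {W \<in> \<L>. W \<inter> T = T - D})"
      using W by blast
  qed
  then have "card \<L> \<le> card (\<Union>i\<le>s. \<Union>D\<in>nsets T i. {W \<in> \<L>. W \<inter> T = T - D})"
    using finL fT finite_imp_finite_nsets[OF fT] by (intro card_mono) auto
  also have "\<dots> \<le> (\<Sum>i\<le>s. card (\<Union>D\<in>nsets T i. {W \<in> \<L>. W \<inter> T = T - D}))"
    by (intro card_UN_le) auto
  also have "\<dots> \<le> (\<Sum>i\<le>s. \<Sum>D\<in>nsets T i. card {W \<in> \<L>. W \<inter> T = T - D})"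
    by (intro sum_mono card_UN_le finite_imp_finite_nsets fT)
  also have "\<dots> \<le> (\<Sum>i\<le>s. \<Sum>D\<in>nsets T i. s ^ i)"
    by (intro sum_mono each)
  also have "\<dots> = (\<Sum>i\<le>s. ((t + s) choose i) * s ^ i)"
    using T(2) by simp
  finally show ?thesis by (simp add: \<L>_def)
qed simp

text \<open>The induction of the cross-intersecting case for one family. Closing twice would not
  keep the family \<open>t\<close>-intersecting, so it is extended to a maximal one instead.\<close>

lemma no_common_subset_bound_self:
  fixes t s k :: nat and r :: real
  assumes fin: "finite \<Omega>" and A: "\<A> \<subseteq> Pow \<Omega>" "weakly_spread \<Omega> r t \<A>"
    and t: "1 \<le> t" and r: "2 * exp 1 * real k \<le> r"
    and "t + s \<le> k" "\<T> \<subseteq> Pow \<Omega>"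
    and "\<And>Y. Y \<in> \<T> \<Longrightarrow> card Y \<le> t + s"
    and "t_intersecting t \<T>"
    and "\<not> (\<exists>X\<in>nsets \<Omega> t. \<forall>Y\<in>\<T>. X \<subseteq> Y)"
  shows "real (card (above \<A> \<T>)) \<le> (1 - (1/2) ^ s) * real (max_degree \<Omega> t \<A>)"
  using assms(6-)
proof (induction s arbitrary: \<T>)
  case 0
  have fins: "finite Y" if "Y \<in> \<T>" for Y
    using that "0.prems"(2) finite_subset[OF _ fin] by auto
  have "\<T> = {}"
  proof (rule ccontr)
    assume "\<T> \<noteq> {}"
    then obtain T where T: "T \<in> \<T>" by auto
    have c: "t \<le> card (T \<inter> Y)" if "Y \<in> \<T>" for Y
      using T that "0.prems"(4) by (auto simp: t_intersecting_def)
    have "T \<subseteq> Y" if "Y \<in> \<T>" for Y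
    proof -
      have "T \<inter> Y = T"
        using c[OF that] T fins "0.prems"(3)[OF T] by (intro card_seteq) auto
      then show ?thesis by auto
    qed
    moreover have "T \<in> nsets \<Omega> t"
      using c[OF T] "0.prems"(2,3) T fins by (fastforce simp: nsets_def)
    ultimately show False using "0.prems"(5) by blast
  qed
  then show ?case by (simp add: above_def)
next
  case (Suc s)
  define a where "a = real (max_degree \<Omega> t \<A>)"
  have a0: "0 \<le> a" by (simp add: a_def)
  have fins: "finite Y" if "Y \<subseteq> \<Omega>" for Y
    using that fin finite_subset by metis
  have finA: "finite (above \<A> \<T>)" for \<T>
    using above_subset[of \<A> \<T>] A(1) fin by (meson finite_Pow_iff finite_subset)
  define good where "good = (\<lambda>\<U>. \<T> \<subseteq> \<U> \<and> \<U> \<subseteq> Pow \<Omega> \<and>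
    (\<forall>U\<in>\<U>. card U \<le> t + Suc s) \<and> t_intersecting t \<U>)"
  have "finite {\<U>. good \<U>}"
    using finite_subset[of "{\<U>. good \<U>}" "Pow (Pow \<Omega>)"] fin by (auto simp: good_def)
  moreover have "good \<T>"
    using Suc.prems by (auto simp: good_def)
  ultimately obtain \<U> where U: "good \<U>" "\<And>\<U>'. good \<U>' \<Longrightarrow> \<U> \<subseteq> \<U>' \<Longrightarrow> \<U> = \<U>'"
    using finite_has_maximal2[of "{\<U>. good \<U>}" \<T>] by auto
  have TU: "\<T> \<subseteq> \<U>" and sub: "\<U> \<subseteq> Pow \<Omega>" and small: "\<And>U. U \<in> \<U> \<Longrightarrow> card U \<le> t + Suc s"
    and int: "t_intersecting t \<U>"
    using U(1) by (auto simp: good_def)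
  have sat: "Y \<in> \<U>" if "Y \<subseteq> \<Omega>" "t \<le> card Y" "card Y \<le> t + Suc s"
    "\<And>V. V \<in> \<U> \<Longrightarrow> t \<le> card (Y \<inter> V)" for Y
  proof -
    \<comment> \<open>\<open>Y\<close> must also meet itself in \<open>t\<close> elements; hence the
      lower bound on \<open>card Y\<close>.\<close>
    have "t_intersecting t (insert Y \<U>)"
      using int that(2,4) by (auto simp: t_intersecting_def Int_commute)
    then have "good (insert Y \<U>)"
      using U(1) that by (auto simp: good_def)
    then show ?thesis using U(2)[of "insert Y \<U>"] by auto
  qed
  define \<U>' where "\<U>' = {U \<in> \<U>. card U \<le> t + s}"
  have "16/3 * real k \<le> 2 * exp 1 * real k"
    using exp_one_ge by (intro mult_right_mono) auto
  then have rk: "2 * real k \<le> r" using r by linarith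
  then have r0: "0 < r" using t Suc.prems(1) by simp
  have rest: "real (card (above \<A> \<U>')) \<le> (1 - (1/2) ^ s) * a"
  proof (cases "\<exists>X\<in>nsets \<Omega> t. \<forall>Y\<in>\<U>'. X \<subseteq> Y")
    case nt: False
    show ?thesis
      unfolding a_def
    proof (rule Suc.IH)
      show "t_intersecting t \<U>'"
        using int by (auto simp: t_intersecting_def \<U>'_def)
    qed (use Suc.prems(1) sub nt in \<open>auto simp: \<U>'_def\<close>)
  next
    case True
    then obtain X where X: "X \<in> nsets \<Omega> t" "\<And>Y. Y \<in> \<U>' \<Longrightarrow> X \<subseteq> Y" by blast
    obtain W where W: "W \<in> \<U>" "\<not> X \<subseteq> W"
      using Suc.prems(5) X(1) TU by blast
    have WO: "W \<subseteq> \<Omega>" "card W \<le> k"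
      using W(1) sub small[OF W(1)] Suc.prems(1) by auto
    define \<epsilon> where "\<epsilon> = real (card W) / r"
    have eps: "\<epsilon> \<le> 1/2"
      using rk r0 WO(2) by (auto simp: \<epsilon>_def field_simps)
    have *: "X \<subseteq> Y \<and> t \<le> card (Y \<inter> W)" if "Y \<in> \<U>'" for Y
      using that X(2) int W(1) by (auto simp: \<U>'_def t_intersecting_def)
    show ?thesis
    proof (cases "s = 0")
      case True
      have "t < card Y" if "Y \<in> \<U>'" for Y
        using card_above_through_common(2)[where \<T> = "\<U>'", OF fin A r0 X(1) WO(1) W(2) *] that sub fins
        by (auto simp: \<U>'_def)
      then have "\<U>' = {}"
        using True by (fastforce simp: \<U>'_def)
      then show ?thesis using True by (simp add: above_def)
    next
      case False
      have "real (card (above \<A> \<U>')) \<le> \<epsilon> * a"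
        unfolding \<epsilon>_def a_def by (rule card_above_through_common(1)[OF fin A r0 X(1) WO(1) W(2) *])
      moreover have "(1/2) ^ s \<le> (1/2 :: real) ^ 1"
        using False by (intro power_decreasing) auto
      then have "\<epsilon> * a \<le> (1 - (1/2) ^ s) * a"
        using eps a0 by (intro mult_right_mono) auto
      ultimately show ?thesis by linarith
    qed
  qed
  define n where "n = t + Suc s"
  have top: "real (card (above \<A> (layer \<U> n))) \<le> (1/2) ^ Suc s * a"
  proof -
    have "layer \<U> n \<subseteq> nsets \<Omega> (t + Suc s)"
      using sub fins by (auto simp: layer_def nsets_def n_def)
    then have "real (card (above \<A> (layer \<U> n))) \<le> real (card (layer \<U> n)) * (a / r ^ Suc s)"
      unfolding a_def by (rule card_above_uniform[OF fin A])
    \<comment> \<open>Each of the \<open>Suc s\<close> factors \<open>1 / r\<close> is matched with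
      one \<open>exp 1 * n\<close>, and
      \<open>exp 1 * n \<le> exp 1 * k \<le> r / 2\<close>.\<close>
    also have "\<dots> \<le> (exp 1 * real n) ^ Suc s * (a / r ^ Suc s)"
    proof (intro mult_right_mono)
      have "real (card (layer \<U> n)) \<le> real (\<Sum>i\<le>Suc s. (n choose i) * Suc s ^ i)"
        unfolding n_def using card_layer_self[OF fin sub int sat small]
        by (simp only: of_nat_le_iff)
      also have "\<dots> = (\<Sum>i\<le>Suc s. real (n choose i) * real (Suc s) ^ i)"
        by (simp only: of_nat_sum of_nat_mult of_nat_power)
      also have "\<dots> \<le> (exp 1 * real n) ^ Suc s"
        by (rule sum_binomial_le_exp) (simp add: n_def)
      finally show "real (card (layer \<U> n)) \<le> (exp 1 * real n) ^ Suc s" .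
    qed (use a0 r0 in auto)
    also have "\<dots> = (exp 1 * real n / r) ^ Suc s * a"
      by (simp only: power_divide times_divide_eq_left times_divide_eq_right)
    also have "\<dots> \<le> (1/2) ^ Suc s * a"
    proof (intro mult_right_mono power_mono)
      have "exp 1 * real n \<le> exp 1 * real k"
        using Suc.prems(1) by (simp add: n_def)
      then have "exp 1 * real n \<le> 1/2 * r"
        using r by linarith
      then show "exp 1 * real n / r \<le> 1/2"
        using r0 by (simp only: pos_divide_le_eq)
    qed (use a0 r0 in auto)
    finally show ?thesis .
  qed
  have "real (card (above \<A> \<T>)) \<le> real (card (above \<A> \<U>))"
    using above_mono[OF TU] finA by (intro of_nat_mono card_mono)
  also have "\<dots> \<le> real (card (above \<A> \<U>')) + real (card (above \<A> (layer \<U> n)))"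
    unfolding \<U>'_def n_def add_Suc_right
    using small sub fins finite_subset[OF A(1)] fin by (intro card_above_le_top_layer) auto
  finally have "real (card (above \<A> \<T>)) \<le> (1 - (1/2) ^ s) * a + (1/2) ^ Suc s * a"
    using rest top by linarith
  also have "\<dots> = (1 - (1/2) ^ Suc s) * a"
    by (simp add: algebra_simps)
  finally show ?case unfolding a_def .
qed

section \<open>Extremal values and the equality cases\<close>

lemma max_degree_attained:
  assumes "finite \<Omega>" "t \<le> card \<Omega>"
  obtains X where "X \<in> nsets \<Omega> t" "card (containing \<A> X) = max_degree \<Omega> t \<A>"
proof -
  have "nsets \<Omega> t \<noteq> {}"
    using assms by (simp add: nsets_eq_empty_iff)
  then have "max_degree \<Omega> t \<A> \<in> (\<lambda>S. card (containing \<A> S)) ` nsets \<Omega> t"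
    unfolding max_degree_def using assms finite_imp_finite_nsets[OF assms(1), of t]
    by (simp add: Max_in)
  then show thesis using that by auto
qed

lemma max_degree_pos:
  assumes "finite \<Omega>" "\<A> \<subseteq> nsets \<Omega> k" "t \<le> k" "\<A> \<noteq> {}"
  shows "0 < max_degree \<Omega> t \<A>"
proof -
  obtain A where A: "A \<in> \<A>" using assms(4) by auto
  then have "A \<subseteq> \<Omega>" "finite A" "card A = k"
    using assms(2) by (auto simp: nsets_def)
  moreover from this obtain X where "X \<subseteq> A" "card X = t" "finite X"
    using obtain_subset_with_card_n[of t A] assms(3) by metis
  ultimately have X: "X \<in> nsets \<Omega> t" "X \<subseteq> A"
    by (auto simp: nsets_def)
  have "finite (containing \<A> X)"
    using finite_subset[OF assms(2) finite_imp_finite_nsets[OF assms(1)]] by (simp add: containing_def)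
  moreover have "A \<in> containing \<A> X" using A X(2) by (simp add: containing_def)
  ultimately have "0 < card (containing \<A> X)" by (auto simp: card_gt_0_iff)
  then show ?thesis
    using card_containing_le_max_degree[OF assms(1) X(1), of \<A>] by linarith
qed

text \<open>The guards of the equality clauses exclude degenerate cases. For
  \<open>t > card \<Omega>\<close> both sides are zero but no \<open>X\<close> exists; if exactly
  one of \<open>\<A>\<close>, \<open>\<B>\<close> is empty, both products vanish whatever subfamily
  of the other is taken.\<close>

theorem theorem1p3:
  fixes \<Omega> :: "'a set" and \<A> \<B> :: "'a set set" and k l t :: nat and r :: real
  assumes "finite \<Omega>" and "1 \<le> t" and "t + 1 \<le> l" and "l \<le> k" and "1 \<le> r"
    and "\<A> \<subseteq> nsets \<Omega> k" and "\<B> \<subseteq> nsets \<Omega> l"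
    and "weakly_spread \<Omega> r t \<A>" and "weakly_spread \<Omega> r t \<B>"
  shows
    "(r \<ge> 2 * exp 1 * real k \<longrightarrow>
       (\<forall>\<F>. \<F> \<subseteq> \<A> \<and> t_intersecting t \<F> \<longrightarrow>
          card \<F> \<le> max_degree \<Omega> t \<A> \<and>
          (t \<le> card \<Omega> \<longrightarrow>
            (card \<F> = max_degree \<Omega> t \<A> \<longleftrightarrow>
              (\<exists>X \<in> nsets \<Omega> t. \<F> = containing \<A> X \<and>
                 card (containing \<A> X) = max_degree \<Omega> t \<A>)))))
     \<and>
     (r \<ge> 2 * exp 1 * max ((real t + 2)\<^sup>2) (real k / (1 - real t / real k)) \<longrightarrow>
       (\<forall>\<F> \<G>. \<F> \<subseteq> \<A> \<and> \<G> \<subseteq> \<B> \<and> cross_t_intersecting t \<F> \<G> \<longrightarrow>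
          card \<F> * card \<G> \<le> max_degree \<Omega> t \<A> * max_degree \<Omega> t \<B> \<and>
          (t \<le> card \<Omega> \<and> (\<A> = {} \<longleftrightarrow> \<B> = {}) \<longrightarrow>
            (card \<F> * card \<G> = max_degree \<Omega> t \<A> * max_degree \<Omega> t \<B> \<longleftrightarrow>
              (\<exists>X \<in> nsets \<Omega> t.
                 \<F> = containing \<A> X \<and> \<G> = containing \<B> X \<and>
                 card (containing \<A> X) = max_degree \<Omega> t \<A> \<and>
                 card (containing \<B> X) = max_degree \<Omega> t \<B>)))))"
proof -
  define a where "a = max_degree \<Omega> t \<A>"
  define b where "b = max_degree \<Omega> t \<B>"
  define s where "s = k - t"
  have s: "t + s = k" and "t < k" using assms(3,4) by (auto simp: s_def)
  have sub: "\<A> \<subseteq> Pow \<Omega>" "\<B> \<subseteq> Pow \<Omega>"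
    using assms(6,7) by (auto simp: nsets_def)
  have cardA: "card A = k" if "A \<in> \<A>" for A using that assms(6) by (auto simp: nsets_def)
  have cardB: "card B \<le> k" if "B \<in> \<B>" for B using that assms(4,7) by (auto simp: nsets_def)
  have fin: "finite \<A>" "finite \<B>"
    using sub assms(1) finite_subset finite_Pow_iff by metis+
  \<comment> \<open>The strict form rules out equality without a common
    \<open>t\<close>-subset.\<close>
  have factor: "(1 - (1/2) ^ s) * c < (c :: real)" if "0 < c" for c
    using that by (simp add: algebra_simps)
  have factor': "(1 - (1/2) ^ s) * c \<le> (c :: real)" if "0 \<le> c" for c
    using that by (simp add: algebra_simps)
  have pos: "\<A> \<noteq> {} \<Longrightarrow> 0 < a" "\<B> \<noteq> {} \<Longrightarrow> 0 < b"
    unfolding a_def b_def using max_degree_pos[OF assms(1)] assms(3,4,6,7) by auto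
  have cardF: "card \<F> \<le> card (above \<C> \<F>)" if "\<F> \<subseteq> \<C>" "finite \<C>" for \<F> \<C> :: "'a set set"
    using card_mono[OF finite_subset[OF above_subset that(2)] subset_above[OF that(1)]] .

  have part1: "card \<F> \<le> a \<and> (t \<le> card \<Omega> \<longrightarrow>
      (card \<F> = a \<longleftrightarrow> (\<exists>X \<in> nsets \<Omega> t. \<F> = containing \<A> X \<and> card (containing \<A> X) = a)))"
    if r: "2 * exp 1 * real k \<le> r" and F: "\<F> \<subseteq> \<A>" "t_intersecting t \<F>" for \<F>
  proof (cases "\<exists>X\<in>nsets \<Omega> t. \<forall>Y\<in>\<F>. X \<subseteq> Y")
    case True
    then obtain X where X: "X \<in> nsets \<Omega> t" "\<forall>Y\<in>\<F>. X \<subseteq> Y" by blast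
    note * = card_le_max_degree_if_common_subset[OF assms(1) sub(1) X(1) F(1) X(2), folded a_def]
    show ?thesis using * X(1) by metis
  next
    case False
    have "real (card (above \<A> \<F>)) \<le> (1 - (1/2) ^ s) * real a"
      unfolding a_def
    proof (rule no_common_subset_bound_self[OF assms(1) sub(1) assms(8,2) r])
      show "card Y \<le> t + s" if "Y \<in> \<F>" for Y
        using that F(1) cardA s by auto
    qed (use s F sub False in auto)
    then have le: "real (card \<F>) \<le> (1 - (1/2) ^ s) * real a"
      using cardF[OF F(1) fin(1)] by linarith
    have "card \<F> \<noteq> a" if "t \<le> card \<Omega>"
    proof -
      \<comment> \<open>For an empty family any \<open>t\<close>-subset of \<open>\<Omega>\<close>
        would be common vacuously.\<close>
      have "\<F> \<noteq> {}"
        using False max_degree_attained[OF assms(1) that, of \<A>] by auto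
      then have "0 < a" using pos(1) F(1) by auto
      then have "real (card \<F>) < real a" using le factor[of "real a"] by linarith
      then show ?thesis by simp
    qed
    moreover have "card \<F> \<le> a" using le factor'[of "real a"] by linarith
    ultimately show ?thesis by auto
  qed

  have part2: "card \<F> * card \<G> \<le> a * b \<and> (t \<le> card \<Omega> \<and> (\<A> = {} \<longleftrightarrow> \<B> = {}) \<longrightarrow>
      (card \<F> * card \<G> = a * b \<longleftrightarrow> (\<exists>X \<in> nsets \<Omega> t. \<F> = containing \<A> X \<and> \<G> = containing \<B> X \<and>
        card (containing \<A> X) = a \<and> card (containing \<B> X) = b)))"
    if r: "2 * exp 1 * max ((real t + 2)\<^sup>2) (real k / (1 - real t / real k)) \<le> r"
      and F: "\<F> \<subseteq> \<A>" "\<G> \<subseteq> \<B>" "cross_t_intersecting t \<F> \<G>" for \<F> \<G>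
  proof (cases "\<exists>X\<in>nsets \<Omega> t. \<forall>Y\<in>\<F> \<union> \<G>. X \<subseteq> Y")
    case True
    then obtain X where X: "X \<in> nsets \<Omega> t" "\<forall>Y\<in>\<F>. X \<subseteq> Y" "\<forall>Y\<in>\<G>. X \<subseteq> Y" by blast
    note eqF = card_le_max_degree_if_common_subset[OF assms(1) sub(1) X(1) F(1) X(2), folded a_def]
    note eqG = card_le_max_degree_if_common_subset[OF assms(1) sub(2) X(1) F(2) X(3), folded b_def]
    have "\<exists>X \<in> nsets \<Omega> t. \<F> = containing \<A> X \<and> \<G> = containing \<B> X \<and>
        card (containing \<A> X) = a \<and> card (containing \<B> X) = b"
      if eq: "card \<F> * card \<G> = a * b" and iff: "\<A> = {} \<longleftrightarrow> \<B> = {}"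
    proof -
      \<comment> \<open>Equal products force equal factors only for positive \<open>a\<close> and
        \<open>b\<close>; if both \<open>\<A>\<close> and \<open>\<B>\<close> are empty, all four
        numbers are zero.\<close>
      have "card \<F> = a \<and> card \<G> = b"
      proof (cases "\<A> = {}")
        case True
        then have e: "containing \<A> Y = {}" "containing \<B> Y = {}" for Y
          using iff by (auto simp: containing_def)
        have "t \<le> card \<Omega>"
          using X(1) assms(1) by (auto simp: nsets_def intro: card_mono)
        then have "a = 0" "b = 0"
          unfolding a_def b_def
          using max_degree_attained[OF assms(1), of t \<A>] max_degree_attained[OF assms(1), of t \<B>] e
          by (metis card.empty)+
        then show ?thesis using eqF(1) eqG(1) by simp
      next
        case False
        then have "0 < a" "0 < b" using pos iff by auto
        then show ?thesis
          using eq eqF(1) eqG(1) mult_less_le_imp_less[of "card \<F>" a "card \<G>" b]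
            mult_le_less_imp_less[of "card \<F>" a "card \<G>" b]
          by (metis le_neq_implies_less less_irrefl mult_eq_0_iff not_gr_zero zero_le)
      qed
      then show ?thesis using eqF(2) eqG(2) X(1) by metis
    qed
    moreover have "card \<F> * card \<G> \<le> a * b"
      using eqF(1) eqG(1) by (rule mult_le_mono)
    ultimately show ?thesis by blast
  next
    case False
    have "real (card (above \<A> \<F>)) * real (card (above \<B> \<G>)) \<le> (1 - (1/2) ^ s) * (real a * real b)"
      unfolding a_def b_def
    proof (rule no_common_subset_bound_cross[OF assms(1) sub(1) assms(8) sub(2) assms(9,2) \<open>t < k\<close> r])
      show "card Y \<le> t + s" if "Y \<in> \<F> \<union> \<G>" for Y
        using that F cardA cardB s by auto
    qed (use s F sub False in auto)
    moreover have "real (card \<F>) * real (card \<G>) \<le> real (card (above \<A> \<F>)) * real (card (above \<B> \<G>))"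
      using cardF[OF F(1) fin(1)] cardF[OF F(2) fin(2)] by (intro mult_mono) auto
    ultimately have le: "real (card \<F> * card \<G>) \<le> (1 - (1/2) ^ s) * real (a * b)"
      by simp
    have "card \<F> * card \<G> \<noteq> a * b" if "t \<le> card \<Omega>" "\<A> = {} \<longleftrightarrow> \<B> = {}"
    proof -
      have "\<F> \<noteq> {} \<or> \<G> \<noteq> {}"
        using False max_degree_attained[OF assms(1) that(1), of \<A>] by auto
      then have "0 < a * b" using pos F that(2) by auto
      then have "real (card \<F> * card \<G>) < real (a * b)"
        using le factor[of "real (a * b)"] by linarith
      then show ?thesis by (simp only: of_nat_less_iff less_not_refl2)
    qed
    moreover have "card \<F> * card \<G> \<le> a * b" using le factor'[of "real (a * b)"] by linarith
    ultimately show ?thesis by auto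
  qed
  show ?thesis
    using part1 part2 unfolding a_def b_def by blast
qed

end
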